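(* Let $x\in\{0,1\}^{\mathbb{N}}$ be rationally almost periodic (RAP). Then $x$ is a good weight for polynomial multiple convergence; that is, for every invertible measure preserving system $(X,\mathcal{B},\mu,T)$, every $\ell\in\mathbb{N}$, all $f_1,\dots,f_\ell\in L^\infty(X,\mu)$ and all polynomials $p_i\in\mathbb{Q}[t]$ with $p_i(\mathbb{Z})\subset\mathbb{Z}$, $i\in\{1,\dots,\ell\}$, the limit $$\lim_{N\to\infty}\frac1N\sum_{n=1}^N x(n)\prod_{i=1}^\ell T^{p_i(n)}f_i$$ exists in $L^2(X,\mathcal{B},\mu)$.
   Context: $\mathbb{N}=\{1,2,3,\dots\}$. Measure preserving systems are on probability spaces and $T^m f=f\circ T^m$. For $x,y\in\{0,1\}^{\mathbb{N}}$ put $d_B(x,y)=\limsup_{N\to\infty}\frac1N|\{1\le n\le N: x(n)\ne y(n)\}|$. A sequence $x\in\{0,1\}^{\mathbb{N}}$ is rationally almost periodic (RAP) if for every $\varepsilon>0$ there is a periodic sequence $y\in\{0,1\}^{\mathbb{N}}$ with $d_B(x,y)<\varepsilon$. *)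

theory Defs
  imports "HOL-Probability.Probability" "HOL-Computational_Algebra.Polynomial"
begin

text \<open>
  Sequences indexed by the positive integers are functions on \<open>nat\<close> whose value at \<open>0\<close> is never
  inspected; a 0-1 sequence is an element of \<open>{1..} \<rightarrow> {0, 1}\<close>.
\<close>

definition besicovitch_dist :: "(nat \<Rightarrow> nat) \<Rightarrow> (nat \<Rightarrow> nat) \<Rightarrow> ereal" where
  "besicovitch_dist x y =
     limsup (\<lambda>N. ereal (real (card {n \<in> {1..N}. x n \<noteq> y n}) / real N))"

definition periodic_seq :: "(nat \<Rightarrow> nat) \<Rightarrow> bool" where
  "periodic_seq y \<longleftrightarrow> (\<exists>q\<ge>1. \<forall>n\<ge>1. y (n + q) = y n)"

definition rationally_almost_periodic :: "(nat \<Rightarrow> nat) \<Rightarrow> bool" where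
  "rationally_almost_periodic x \<longleftrightarrow>
     (\<forall>\<epsilon>::real. \<epsilon> > 0 \<longrightarrow>
        (\<exists>y \<in> {1..} \<rightarrow> {0, 1}. periodic_seq y \<and> besicovitch_dist x y < ereal \<epsilon>))"

definition invertible_mps :: "'a measure \<Rightarrow> ('a \<Rightarrow> 'a) \<Rightarrow> bool" where
  "invertible_mps M T \<longleftrightarrow>
     prob_space M \<and>
     bij_betw T (space M) (space M) \<and>
     T \<in> measurable M M \<and>
     the_inv_into (space M) T \<in> measurable M M \<and>
     (\<forall>A \<in> sets M. emeasure M (T -` A \<inter> space M) = emeasure M A)"

text \<open>Integer iterates of \<open>T\<close>; meaningful only at points of \<open>space M\<close>.\<close>

definition int_iterate :: "'a measure \<Rightarrow> ('a \<Rightarrow> 'a) \<Rightarrow> int \<Rightarrow> 'a \<Rightarrow> 'a" where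
  "int_iterate M T m =
     (if m \<ge> 0 then T ^^ nat m else the_inv_into (space M) T ^^ nat (- m))"

definition koopman :: "'a measure \<Rightarrow> ('a \<Rightarrow> 'a) \<Rightarrow> int \<Rightarrow> ('a \<Rightarrow> complex) \<Rightarrow> 'a \<Rightarrow> complex" where
  "koopman M T m f = f \<circ> int_iterate M T m"

text \<open>
  The spaces below consist of functions rather than of classes modulo null sets. Essential
  boundedness and \<open>L\<^sup>2\<close> convergence do not depend on the choice of representatives.
\<close>

definition Linf :: "'a measure \<Rightarrow> ('a \<Rightarrow> complex) set" where
  "Linf M = {f \<in> borel_measurable M. \<exists>C::real. AE \<omega> in M. norm (f \<omega>) \<le> C}"

definition L2 :: "'a measure \<Rightarrow> ('a \<Rightarrow> complex) set" where
  "L2 M = {f \<in> borel_measurable M. integrable M (\<lambda>\<omega>. (norm (f \<omega>))\<^sup>2)}"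

definition has_L2_limit :: "'a measure \<Rightarrow> (nat \<Rightarrow> 'a \<Rightarrow> complex) \<Rightarrow> ('a \<Rightarrow> complex) \<Rightarrow> bool" where
  "has_L2_limit M F g \<longleftrightarrow>
     g \<in> L2 M \<and>
     (\<lambda>N. \<integral>\<^sup>+ \<omega>. ennreal ((norm (F N \<omega> - g \<omega>))\<^sup>2) \<partial>M) \<longlonglongrightarrow> 0"

definition integer_valued :: "rat poly \<Rightarrow> bool" where
  "integer_valued p \<longleftrightarrow> (\<forall>k::int. poly p (of_int k) \<in> \<int>)"

text \<open>For an integer-valued polynomial the floor is exact and only converts from \<open>rat\<close> to \<open>int\<close>.\<close>

definition weighted_poly_average ::
  "(nat \<Rightarrow> nat) \<Rightarrow> 'a measure \<Rightarrow> ('a \<Rightarrow> 'a) \<Rightarrow> nat \<Rightarrow> (nat \<Rightarrow> rat poly) \<Rightarrow> (nat \<Rightarrow> 'a \<Rightarrow> complex)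
     \<Rightarrow> nat \<Rightarrow> 'a \<Rightarrow> complex" where
  "weighted_poly_average x M T l p f N \<omega> =
     (1 / of_nat N) *
     (\<Sum>n=1..N. of_nat (x n) * (\<Prod>i=1..l. koopman M T \<lfloor>poly (p i) (of_nat n)\<rfloor> (f i) \<omega>))"

end

theory Submission
  imports Defs "HOL-Library.Function_Algebras"
begin

text \<open>
  A rationally almost periodic weight is within \<open>\<epsilon>\<close>, in upper density, of a periodic one, and changing
  the weight on a set of upper density \<open>\<epsilon>\<close> changes the late averages by at most a constant multiple of
  \<open>\<epsilon>\<close> in \<open>L\<^sup>2\<close>. So it suffices that averages with a periodic weight are Cauchy. A periodic scalar weight costs nothing in
  the argument, which is otherwise Walsh's proof of norm convergence for polynomial averages,
  specialised to a single action of the integers.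

  Ordinary convergence is too weak for the induction, because the averages of one system are
  compared with averages, over a parameter \<open>m\<close>, of averages of infinitely many simpler systems.
  The induction therefore carries \<^emph>\<open>uniform metastability\<close>: for each \<open>\<epsilon>\<close> there is a number \<open>K\<close>
  such that, for every growth function \<open>F\<close>, some \<open>K\<close> scales suffice for the whole family: each
  sequence of the family is constant up to \<open>\<epsilon>\<close> on \<open>[t, F t]\<close> for one of these \<open>t\<close>. As \<open>K\<close> does
  not depend on \<open>F\<close>, a pigeonhole argument transfers the property to mixtures of members of the
  family (\<open>metastable_mixtures\<close>). For a single sequence it is equivalent to being Cauchy.

  For the inductive step let \<open>A\<^sub>N u\<close> be the average over \<open>n\<close> of \<open>\<psi> n \<cdot> u \<circ> S (p n)\<close>, where \<open>\<psi>\<close>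
  collects the other factors. If \<open>A\<^sub>N u\<close> is not small, put \<open>h = A\<^sub>N u\<close>; the adjoint of \<open>A\<^sub>N\<close> applied to
  \<open>h\<close> is a function \<open>\<sigma>\<close> with \<open>\<langle>u, \<sigma>\<rangle> = \<parallel>h\<parallel>\<^sup>2\<close> and \<open>\<parallel>\<sigma>\<parallel> \<le> \<parallel>h\<parallel>\<close>, so that \<open>u - \<sigma>\<close> has energy at
  most \<open>\<parallel>u\<parallel>\<^sup>2 - \<parallel>h\<parallel>\<^sup>2\<close> (\<open>energy_decrement\<close>). On the other hand, at scales well below \<open>N\<close> the averages
  of \<open>\<sigma>\<close> are mixtures of averages of simpler systems (\<open>dual_approximation\<close>), which are metastable by
  induction. Repeating this with \<open>u - \<sigma>\<close> uses up the energy in boundedly many rounds; with the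
  scales of later rounds fixed first and far below those of earlier rounds, one of the rounds ends
  with a good scale (\<open>metastable_decomposed\<close>).

  "Simpler" refers to the system of exponent sequences. The step replaces a system \<open>Q\<close> by the
  sequences \<open>r\<close> and \<open>r + \<Delta>\<^sub>m (r - p)\<close> with \<open>r \<in> Q\<close>, \<open>r - p\<close> not constant, and by \<open>- \<Delta>\<^sub>m p\<close>.
  For a good choice of \<open>p\<close> at every stage, and whatever values \<open>m\<close> takes, only constant sequences are
  left after a number of steps that depends only on the size of \<open>Q\<close> and on the degree
  (\<open>complexity_bounded\<close>). For constant exponents only the periodic weight is averaged.
\<close>

section \<open>Integer sequences of bounded degree\<close>

definition shift_diff :: "nat \<Rightarrow> (nat \<Rightarrow> int) \<Rightarrow> nat \<Rightarrow> int" where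
  "shift_diff m r = (\<lambda>n. r (n + m) - r n)"

text \<open>
  Of the exponent polynomials only two facts are used: repeated differencing annihilates them, and
  this property is stable under sums and differences. It is therefore taken as the definition of the
  degree, which makes sense for any integer sequence.
\<close>
primrec degree_le :: "nat \<Rightarrow> (nat \<Rightarrow> int) \<Rightarrow> bool" where
  "degree_le 0 r \<longleftrightarrow> (\<forall>n. r n = r 0)"
| "degree_le (Suc D) r \<longleftrightarrow> (\<forall>m. degree_le D (shift_diff m r))"

lemma shift_diff_diff: "shift_diff m (r - s) = shift_diff m r - shift_diff m s"
  and shift_diff_zero: "shift_diff m 0 = 0"
  by (auto simp: shift_diff_def fun_eq_iff)

lemma degree_le_zero [simp]: "degree_le D 0"
proof -
  have "degree_le D (\<lambda>_. 0)" by (induction D) (auto simp: shift_diff_def)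
  then show ?thesis by (simp add: zero_fun_def)
qed

lemma degree_le_diff: "degree_le D r \<Longrightarrow> degree_le D s \<Longrightarrow> degree_le D (r - s)"
  by (induction D arbitrary: r s) (auto simp: shift_diff_diff; metis)+

lemma degree_le_uminus: "degree_le D r \<Longrightarrow> degree_le D (- r)"
  using degree_le_diff[of D 0 r] by simp

lemma degree_le_add: "degree_le D r \<Longrightarrow> degree_le D s \<Longrightarrow> degree_le D (r + s)"
  using degree_le_diff[of D r "- s"] degree_le_uminus[of D s] by simp

lemma degree_le_Suc: "degree_le D r \<Longrightarrow> degree_le (Suc D) r"
proof (induction D arbitrary: r)
  case 0
  then have "shift_diff m r = 0" for m
    unfolding shift_diff_def fun_eq_iff by (metis cancel_comm_monoid_add_class.diff_cancel degree_le.simps(1) zero_fun_apply)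
  then show ?case by simp
next
  case (Suc D)
  then show ?case by (metis degree_le.simps(2))
qed

lemma degree_le_mono: "D \<le> E \<Longrightarrow> degree_le D r \<Longrightarrow> degree_le E r"
  by (induction E rule: dec_induct) (use degree_le_Suc in blast)+

declare degree_le.simps(2) [simp del]

section \<open>The descent on finite systems of sequences\<close>

text \<open>
  Exponents of the simpler averages produced from a system \<open>Q\<close> by eliminating \<open>p\<close>. A factor with
  exponent \<open>r n\<close> gives rise to itself and to its copy at time \<open>n + m\<close>, transported by \<open>p n - p (n + m)\<close>:
  \<open>r (n + m) + p n - p (n + m)\<close> is the value at \<open>n\<close> of \<open>r + \<Delta>\<^sub>m (r - p)\<close>, and the zero exponent becomes
  \<open>- \<Delta>\<^sub>m p\<close>. Sequences that differ from \<open>p\<close> by a constant are absorbed into the factor being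
  eliminated.
\<close>
definition descendants :: "(nat \<Rightarrow> int) \<Rightarrow> nat \<Rightarrow> (nat \<Rightarrow> int) set \<Rightarrow> (nat \<Rightarrow> int) set" where
  "descendants p m Q =
     (let R = {r \<in> Q. \<not> degree_le 0 (r - p)}
      in R \<union> (\<lambda>r. r + shift_diff m (r - p)) ` R \<union> {- shift_diff m p})"

text \<open>
  A game of exactly \<open>d\<close> rounds: in each of them the player chooses \<open>p\<close> and the opponent answers with
  \<open>m\<close>. The number of rounds must not depend on the answers, since the averages to be compared involve
  all \<open>m\<close> at once.
\<close>
primrec reaches :: "((nat \<Rightarrow> int) set \<Rightarrow> bool) \<Rightarrow> nat \<Rightarrow> (nat \<Rightarrow> int) set \<Rightarrow> bool" where
  "reaches G 0 Q \<longleftrightarrow> G Q"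
| "reaches G (Suc d) Q \<longleftrightarrow> (\<exists>p. \<forall>m. reaches G d (descendants p m Q))"

lemma reaches_trans:
  assumes "reaches G d Q" "\<And>R. G R \<Longrightarrow> reaches H e R"
  shows "reaches H (d + e) Q"
  using assms(1)
proof (induction d arbitrary: Q)
  case 0
  then show ?case using assms(2) by simp
next
  case (Suc d)
  then show ?case by (simp) metis
qed

lemma reaches_mono: "reaches G d Q \<Longrightarrow> (\<And>R. G R \<Longrightarrow> H R) \<Longrightarrow> reaches H d Q"
  using reaches_trans[of G d Q H 0] by simp

text \<open>
  While the sequences near \<open>a\<close> are being eliminated, every other sequence \<open>b\<close> is perturbed. What
  survives is its class at each degree: if \<open>b - a\<close> has degree at most \<open>e + 1\<close>, then a descendant \<open>q\<close>
  of \<open>b\<close> differs from \<open>b\<close> by degree at most \<open>e\<close>. Only degrees \<open>e + 1 \<ge> D\<close> are recorded, where \<open>D\<close>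
  bounds the degree within the class being eliminated.
\<close>
definition follows :: "nat \<Rightarrow> (nat \<Rightarrow> int) \<Rightarrow> (nat \<Rightarrow> int) \<Rightarrow> (nat \<Rightarrow> int) \<Rightarrow> bool" where
  "follows D a b q \<longleftrightarrow> (\<forall>e. D \<le> Suc e \<longrightarrow> degree_le (Suc e) (b - a) \<longrightarrow> degree_le e (q - b))"

definition traces :: "nat \<Rightarrow> (nat \<Rightarrow> int) \<Rightarrow> (nat \<Rightarrow> int) set \<Rightarrow> nat \<Rightarrow> (nat \<Rightarrow> int) set \<Rightarrow> bool" where
  "traces D a B k Q \<longleftrightarrow> finite Q \<and> card Q \<le> k \<and> (\<forall>q\<in>Q. \<exists>b\<in>insert 0 B. follows D a b q)"

lemma follows_self: "follows D a b b"
  by (simp add: follows_def)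

lemma follows_descendant: "follows D a b (b + shift_diff m (b - a))"
  by (simp add: follows_def degree_le.simps(2))

lemma followsD: "follows D a b q \<Longrightarrow> D \<le> Suc e \<Longrightarrow> degree_le (Suc e) (b - a) \<Longrightarrow> degree_le e (q - b)"
  by (simp add: follows_def)

lemma eliminate_single_class:
  assumes A: "finite A" "\<forall>r\<in>A. degree_le 0 (r - a)" and B: "finite B" "card B \<le> t"
  shows "reaches (traces 0 a B (2 * t + 1)) (Suc 0) (A \<union> B)"
proof -
  have "traces 0 a B (2 * t + 1) (descendants a m (A \<union> B))" for m
  proof -
    define R where "R = {r \<in> A \<union> B. \<not> degree_le 0 (r - a)}"
    have R: "R \<subseteq> B" "finite R" using A B by (auto simp: R_def)
    have desc: "descendants a m (A \<union> B)
        = R \<union> (\<lambda>r. r + shift_diff m (r - a)) ` R \<union> {- shift_diff m a}"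
      unfolding descendants_def R_def by (simp add: Let_def)
    have "card (descendants a m (A \<union> B)) \<le> card R + card R + 1"
      unfolding desc using R(2)
      by (intro order_trans[OF card_Un_le] add_mono card_image_le) auto
    moreover have "card R \<le> t" using R B card_mono le_trans by blast
    moreover have "\<exists>b\<in>insert 0 B. follows 0 a b q" if q: "q \<in> descendants a m (A \<union> B)" for q
    proof -
      consider "q \<in> R" | r where "r \<in> R" "q = r + shift_diff m (r - a)" | "q = - shift_diff m a"
        using q unfolding desc by blast
      then show ?thesis
      proof cases
        case 1
        then show ?thesis using R(1) follows_self by blast
      next
        case 2
        then show ?thesis using R(1) follows_descendant by blast
      next
        case 3
        then have "q = 0 + shift_diff m (0 - a)" unfolding shift_diff_diff shift_diff_zero by simp
        then show ?thesis using follows_descendant by blast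
      qed
    qed
    ultimately show ?thesis
      unfolding traces_def using R(2) by (auto simp: desc)
  qed
  then show ?thesis by (simp) blast
qed

text \<open>
  A class \<open>A\<close> of sequences with pairwise differences of degree at most \<open>D\<close> can be eliminated, leaving
  descendants of \<open>B\<close> and of \<open>0\<close>. The proof is by induction on \<open>D\<close>: the class splits into finitely many
  classes modulo degree \<open>D - 1\<close>, and these are eliminated one after the other. Eliminating one of
  them multiplies the members of the others, but by \<open>follows\<close> it does not increase the number of
  classes.
\<close>
lemma eliminate_class:
  "\<exists>d k. \<forall>A B a. finite A \<longrightarrow> card A \<le> s \<longrightarrow> finite B \<longrightarrow> card B \<le> t \<longrightarrow>
     (\<forall>r\<in>A. degree_le D (r - a)) \<longrightarrow> reaches (traces D a B k) d (A \<union> B)"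
proof (induction D arbitrary: s t)
  case 0
  show ?case
    using eliminate_single_class[where t = t] by blast
next
  case (Suc D)
  note outer = Suc.IH
  have classes: "\<exists>d k. \<forall>A B a rs. finite A \<longrightarrow> card A \<le> s \<longrightarrow> finite B \<longrightarrow> card B \<le> t \<longrightarrow>
      length rs = c \<longrightarrow> (\<forall>r\<in>set rs. degree_le (Suc D) (r - a)) \<longrightarrow>
      (\<forall>q\<in>A. \<exists>r\<in>set rs. degree_le D (q - r)) \<longrightarrow> reaches (traces (Suc D) a B k) d (A \<union> B)" for c s t
  proof (induction c arbitrary: s t)
    case 0
    have "traces (Suc D) a B t B" if "finite B" "card B \<le> t" for a B
      using that unfolding traces_def by (blast intro: follows_self)
    then show ?case by (intro exI[of _ 0] exI[of _ t]) auto
  next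
    case (Suc c)
    obtain d k where dk: "\<And>A B a. finite A \<Longrightarrow> card A \<le> s \<Longrightarrow> finite B \<Longrightarrow> card B \<le> s + t \<Longrightarrow>
       (\<forall>r\<in>A. degree_le D (r - a)) \<Longrightarrow> reaches (traces D a B k) d (A \<union> B)"
      using outer[of s "s + t"] by blast
    obtain d' k' where dk': "\<And>A B a rs. finite A \<Longrightarrow> card A \<le> k \<Longrightarrow> finite B \<Longrightarrow> card B \<le> k \<Longrightarrow>
      length rs = c \<Longrightarrow> (\<forall>r\<in>set rs. degree_le (Suc D) (r - a)) \<Longrightarrow>
      (\<forall>q\<in>A. \<exists>r\<in>set rs. degree_le D (q - r)) \<Longrightarrow> reaches (traces (Suc D) a B k') d' (A \<union> B)"
      using Suc.IH[of k k] by blast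
    have "reaches (traces (Suc D) a B k') (d + d') (A \<union> B)"
      if A: "finite A" "card A \<le> s" and B: "finite B" "card B \<le> t" and rs: "length rs = Suc c"
        "\<forall>r\<in>set rs. degree_le (Suc D) (r - a)" "\<forall>q\<in>A. \<exists>r\<in>set rs. degree_le D (q - r)" for A B a rs
    proof -
      obtain r rs' where rs': "rs = r # rs'" "length rs' = c" using rs(1) by (cases rs) auto
      define A1 where "A1 = {q \<in> A. degree_le D (q - r)}"
      define A2 where "A2 = A - A1"
      have cards: "card A1 \<le> s" "card (A2 \<union> B) \<le> s + t"
        using A B card_mono[of A A1] card_mono[of A A2] card_Un_le[of A2 B]
        by (auto simp: A1_def A2_def)
      have "reaches (traces D r (A2 \<union> B) k) d (A1 \<union> (A2 \<union> B))"
        using A B cards by (intro dk) (auto simp: A1_def A2_def)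
      moreover have "A1 \<union> (A2 \<union> B) = A \<union> B" by (auto simp: A1_def A2_def)
      moreover have "reaches (traces (Suc D) a B k') d' Q" if Q: "traces D r (A2 \<union> B) k Q" for Q
      proof -
        define A' where "A' = {q \<in> Q. \<exists>b\<in>A2. follows D r b q}"
        define B' where "B' = {q \<in> Q. \<exists>b\<in>insert 0 B. follows D r b q}"
        have Q': "finite Q" "card Q \<le> k" "Q = A' \<union> B'"
          using Q unfolding traces_def A'_def B'_def by blast+
        have r: "degree_le (Suc e) (r - a)" if "D \<le> e" for e
          using that rs(2) rs' degree_le_mono[of "Suc D" "Suc e"] by simp
        have "reaches (traces (Suc D) a B' k') d' (A' \<union> B')"
        proof (rule dk')
          show "finite A'" "finite B'" "card A' \<le> k" "card B' \<le> k"
            using Q' card_mono[of Q A'] card_mono[of Q B'] by auto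
          show "length rs' = c" "\<forall>r\<in>set rs'. degree_le (Suc D) (r - a)" using rs rs' by auto
          show "\<forall>q\<in>A'. \<exists>r\<in>set rs'. degree_le D (q - r)"
          proof
            fix q assume "q \<in> A'"
            then obtain b where b: "b \<in> A2" "follows D r b q" by (auto simp: A'_def)
            obtain r' where r': "r' \<in> set rs'" "degree_le D (b - r')"
              using b(1) rs(3) rs' by (auto simp: A1_def A2_def)
            have "degree_le (Suc D) (r' - a)" using r' rs(2) rs' by auto
            from degree_le_diff[OF degree_le_add[OF degree_le_Suc[OF r'(2)] this] r[OF order_refl]]
            have "degree_le (Suc D) (b - r)" by simp
            then have "degree_le D (q - b)" using followsD[OF b(2)] by simp
            from degree_le_add[OF this r'(2)] show "\<exists>r\<in>set rs'. degree_le D (q - r)"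
              using r'(1) by auto
          qed
        qed
        then show ?thesis
          unfolding Q'(3)
        proof (rule reaches_mono)
          fix R assume R: "traces (Suc D) a B' k' R"
          have "\<exists>b\<in>insert 0 B. follows (Suc D) a b x" if x: "x \<in> R" for x
          proof -
            obtain q where q: "q \<in> insert 0 B'" "follows (Suc D) a q x"
              using R x unfolding traces_def by blast
            obtain b where b: "b \<in> insert 0 B" "follows D r b q"
              using q(1) follows_self[of D r 0] by (auto simp: B'_def)
            have "degree_le e (x - b)" if e: "Suc D \<le> Suc e" "degree_le (Suc e) (b - a)" for e
            proof -
              have "degree_le (Suc e) (b - r)"
                using degree_le_diff[OF e(2) r[of e]] e(1) by simp
              then have qb: "degree_le e (q - b)" using followsD[OF b(2), of e] e by simp
              have "degree_le (Suc e) (q - a)"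
                using degree_le_add[OF degree_le_Suc[OF qb] e(2)] by simp
              then have "degree_le e (x - q)" using followsD[OF q(2), of e] e by simp
              from degree_le_add[OF this qb] show ?thesis by simp
            qed
            then show ?thesis using b(1) unfolding follows_def by blast
          qed
          then show "traces (Suc D) a B k' R" using R unfolding traces_def by blast
        qed
      qed
      ultimately show ?thesis using reaches_trans by metis
    qed
    then show ?case by blast
  qed
  obtain d k where dk: "\<And>A B a rs. finite A \<Longrightarrow> card A \<le> s \<Longrightarrow> finite B \<Longrightarrow> card B \<le> t \<Longrightarrow>
      length rs = s \<Longrightarrow> (\<forall>r\<in>set rs. degree_le (Suc D) (r - a)) \<Longrightarrow>
      (\<forall>q\<in>A. \<exists>r\<in>set rs. degree_le D (q - r)) \<Longrightarrow> reaches (traces (Suc D) a B k) d (A \<union> B)"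
    using classes[of s t s] by blast
  have "reaches (traces (Suc D) a B k) d (A \<union> B)"
    if A: "finite A" "card A \<le> s" "\<forall>r\<in>A. degree_le (Suc D) (r - a)" and B: "finite B" "card B \<le> t" for A B a
  proof -
    obtain xs where xs: "set xs = A" "length xs = card A"
      using A(1) finite_distinct_list distinct_card by metis
    show ?thesis
      by (rule dk[of A B "xs @ replicate (s - card A) a"])
        (use A B xs in \<open>auto intro!: bexI[where P="\<lambda>r. degree_le D (_ - r)"]\<close>)
  qed
  then show ?case by blast
qed

definition complexity_le :: "nat \<Rightarrow> (nat \<Rightarrow> int) set \<Rightarrow> bool" where
  "complexity_le = reaches (\<lambda>Q. \<forall>r\<in>Q. degree_le 0 r)"

text \<open>
  Applied to the whole system as one class around \<open>a = 0\<close>, the elimination leaves only descendants of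
  \<open>0\<close>, and these have degree smaller by one.
\<close>
lemma complexity_bounded:
  "\<exists>d. \<forall>Q. finite Q \<longrightarrow> card Q \<le> s \<longrightarrow> (\<forall>r\<in>Q. degree_le D r) \<longrightarrow> complexity_le d Q"
proof (induction D arbitrary: s)
  case 0
  show ?case by (rule exI[of _ 0]) (auto simp: complexity_le_def)
next
  case (Suc D)
  obtain d k where dk: "\<And>A. finite A \<Longrightarrow> card A \<le> s \<Longrightarrow> \<forall>r\<in>A. degree_le (Suc D) (r - 0) \<Longrightarrow>
      reaches (traces (Suc D) 0 {} k) d (A \<union> {})"
    using eliminate_class[of s 0 "Suc D"] by (metis card.empty finite.emptyI order_refl)
  obtain e where e: "\<And>Q. finite Q \<Longrightarrow> card Q \<le> k \<Longrightarrow> \<forall>r\<in>Q. degree_le D r \<Longrightarrow> complexity_le e Q"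
    using Suc.IH[of k] by blast
  have "complexity_le (d + e) Q" if Q: "finite Q" "card Q \<le> s" "\<forall>r\<in>Q. degree_le (Suc D) r" for Q
  proof -
    have "reaches (traces (Suc D) 0 {} k) d Q"
      using dk[of Q] Q by simp
    moreover have "complexity_le e R" if "traces (Suc D) 0 {} k R" for R
      using that followsD[of "Suc D" 0 0 _ D] by (intro e) (auto simp: traces_def)
    ultimately show ?thesis unfolding complexity_le_def by (rule reaches_trans)
  qed
  then show ?case by blast
qed

lemma degree_shifted_poly_diff:
  fixes p :: "'b::idom poly"
  shows "degree (pcompose p [:c, 1:] - p) \<le> degree p - 1"
proof (induction p)
  case 0
  then show ?case by simp
next
  case (pCons a p)
  let ?d = "pcompose p [:c, 1:] - p"
  have eq: "pcompose (pCons a p) [:c, 1:] - pCons a p = pCons 0 ?d + smult c (pcompose p [:c, 1:])"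
    by (simp add: pcompose_pCons algebra_simps)
  show ?case
  proof (cases "degree p = 0")
    case True
    then obtain b where "p = [:b:]" by (metis degree_eq_zeroE)
    then show ?thesis by (simp add: pcompose_pCons)
  next
    case False
    have "degree (pCons 0 ?d) \<le> degree p" 
      using pCons.IH False degree_pCons_le[of 0 ?d] by linarith
    moreover have "degree (smult c (pcompose p [:c, 1:])) \<le> degree p"
      using degree_pcompose_le[of p "[:c, 1:]"] degree_smult_le[of c "pcompose p [:c, 1:]"] by simp
    moreover have "degree (pCons a p) - 1 = degree p" using False by auto
    ultimately show ?thesis unfolding eq by (metis degree_add_le)
  qed
qed

lemma degree_le_poly:
  fixes p :: "'b::{idom, ring_char_0} poly"
  assumes "degree p \<le> D" "\<And>n. of_int (r n) = poly p (of_nat n)"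
  shows "degree_le D r"
  using assms
proof (induction D arbitrary: p r)
  case 0
  then obtain b where "p = [:b:]" by (metis degree_eq_zeroE le_zero_eq)
  then have "(of_int (r n) :: 'b) = of_int (r 0)" for n using 0(2) by simp
  then show ?case by simp
next
  case (Suc D)
  have "degree_le D (shift_diff m r)" for m
  proof (rule Suc.IH)
    show "degree (pcompose p [:of_nat m, 1:] - p) \<le> D"
      using degree_shifted_poly_diff[of p "of_nat m"] Suc.prems(1) by linarith
    show "of_int (shift_diff m r n) = poly (pcompose p [:of_nat m, 1:] - p) (of_nat n)" for n
      using Suc.prems(2) by (simp add: shift_diff_def poly_pcompose add.commute)
  qed
  then show ?case by (simp add: degree_le.simps(2))
qed

section \<open>The \<open>L\<^sup>2\<close> seminorm on bounded functions\<close>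

context prob_space
begin

text \<open>
  Functions with a bound valid at every point, not only almost everywhere, so that pointwise
  estimates need no exceptional sets. Essentially bounded functions are brought to this form once,
  at the very end.
\<close>
definition bounded_by :: "real \<Rightarrow> ('a \<Rightarrow> complex) set" where
  "bounded_by C = {f \<in> borel_measurable M. \<forall>\<omega>\<in>space M. norm (f \<omega>) \<le> C}"

definition l2norm :: "('a \<Rightarrow> complex) \<Rightarrow> real" where
  "l2norm f = sqrt (\<integral>\<omega>. (norm (f \<omega>))\<^sup>2 \<partial>M)"

lemma bounded_by_measurable: "f \<in> bounded_by C \<Longrightarrow> f \<in> borel_measurable M"
  by (simp add: bounded_by_def)

lemma bounded_byD: "f \<in> bounded_by C \<Longrightarrow> \<omega> \<in> space M \<Longrightarrow> norm (f \<omega>) \<le> C"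
  by (simp add: bounded_by_def)

lemma bounded_by_nonneg: "f \<in> bounded_by C \<Longrightarrow> 0 \<le> C"
  using not_empty unfolding bounded_by_def by (force intro: order_trans[OF norm_ge_zero])

lemma bounded_by_add:
  assumes "f \<in> bounded_by C" "g \<in> bounded_by D"
  shows "f + g \<in> bounded_by (C + D)"
  using assms unfolding bounded_by_def plus_fun_def by (auto intro: norm_triangle_le add_mono)

lemma bounded_by_diff:
  assumes "f \<in> bounded_by C" "g \<in> bounded_by D"
  shows "f - g \<in> bounded_by (C + D)"
  using assms unfolding bounded_by_def fun_diff_def by (auto intro: norm_triangle_le_diff add_mono)

lemma bounded_by_mult:
  assumes "f \<in> bounded_by C" "g \<in> bounded_by D"
  shows "(\<lambda>\<omega>. f \<omega> * g \<omega>) \<in> bounded_by (C * D)"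
  using assms bounded_by_nonneg[OF assms(1)] unfolding bounded_by_def
  by (auto simp: norm_mult intro: mult_mono)

lemma bounded_by_const: "norm c \<le> C \<Longrightarrow> (\<lambda>\<omega>. c) \<in> bounded_by C"
  by (auto simp: bounded_by_def)

lemma bounded_by_cnj: "f \<in> bounded_by C \<Longrightarrow> (\<lambda>\<omega>. cnj (f \<omega>)) \<in> bounded_by C"
  unfolding bounded_by_def
  by (auto intro!: measurable_compose[of f M borel cnj] borel_measurable_continuous_onI continuous_on_cnj continuous_on_id)

lemma bounded_by_sum:
  assumes "\<And>i. i \<in> I \<Longrightarrow> f i \<in> bounded_by (C i)"
  shows "(\<lambda>\<omega>. \<Sum>i\<in>I. f i \<omega>) \<in> bounded_by (\<Sum>i\<in>I. C i)"
  using assms unfolding bounded_by_def by (auto intro!: sum_norm_le borel_measurable_sum)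

lemma integrable_norm_sq: "f \<in> bounded_by C \<Longrightarrow> integrable M (\<lambda>\<omega>. (norm (f \<omega>))\<^sup>2)"
  by (rule integrable_const_bound[where B = "C\<^sup>2"])
    (auto simp: bounded_by_def intro!: power_mono)

lemma integrable_bounded: "f \<in> bounded_by C \<Longrightarrow> integrable M f"
  by (rule integrable_const_bound[where B = C]) (auto simp: bounded_by_def)

lemma l2norm_nonneg: "0 \<le> l2norm f"
  by (simp add: l2norm_def)

lemma l2norm_sq: "(l2norm f)\<^sup>2 = (\<integral>\<omega>. (norm (f \<omega>))\<^sup>2 \<partial>M)"
  by (simp add: l2norm_def)

lemma l2norm_cong: "(\<And>\<omega>. \<omega> \<in> space M \<Longrightarrow> norm (f \<omega>) = norm (g \<omega>)) \<Longrightarrow> l2norm f = l2norm g"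
  unfolding l2norm_def by (metis (no_types, lifting) Bochner_Integration.integral_cong)

lemma l2norm_mono:
  assumes "f \<in> borel_measurable M" "g \<in> bounded_by C" "\<And>\<omega>. \<omega> \<in> space M \<Longrightarrow> norm (f \<omega>) \<le> norm (g \<omega>)"
  shows "l2norm f \<le> l2norm g"
  unfolding l2norm_def
proof (intro real_sqrt_le_mono integral_mono)
  have "f \<in> bounded_by C"
    using assms unfolding bounded_by_def by (auto intro: order_trans)
  then show "integrable M (\<lambda>\<omega>. (norm (f \<omega>))\<^sup>2)" by (rule integrable_norm_sq)
  show "integrable M (\<lambda>\<omega>. (norm (g \<omega>))\<^sup>2)" using assms(2) by (rule integrable_norm_sq)
qed (use assms(3) in \<open>auto intro: power_mono\<close>)

lemma l2norm_const: "l2norm (\<lambda>\<omega>. c) = norm c"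
  by (simp add: l2norm_def prob_space)

lemma l2norm_le:
  assumes "f \<in> bounded_by C"
  shows "l2norm f \<le> C"
  using l2norm_mono[of f "\<lambda>\<omega>. of_real C" C] assms bounded_by_nonneg[OF assms]
  by (auto simp: bounded_by_def l2norm_const)

lemma l2norm_scale: "l2norm (\<lambda>\<omega>. c * f \<omega>) = norm c * l2norm f"
  by (simp add: l2norm_def norm_mult power_mult_distrib real_sqrt_mult)

text \<open>
  For any \<open>a > \<parallel>f\<parallel>\<close> and \<open>b > \<parallel>g\<parallel>\<close>, convexity of the square gives
  \<open>\<bar>f + g\<bar>\<^sup>2 \<le> (a + b) (\<bar>f\<bar>\<^sup>2 / a + \<bar>g\<bar>\<^sup>2 / b)\<close>, whose integral is at most \<open>(a + b)\<^sup>2\<close>. This replaces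
  the Cauchy-Schwarz inequality.
\<close>
lemma l2norm_triangle:
  assumes f: "f \<in> bounded_by C" and g: "g \<in> bounded_by D"
  shows "l2norm (f + g) \<le> l2norm f + l2norm g"
proof (rule field_le_epsilon)
  fix e :: real assume e: "0 < e"
  define a where "a = l2norm f + e / 2"
  define b where "b = l2norm g + e / 2"
  have ab: "a > 0" "b > 0" "l2norm f \<le> a" "l2norm g \<le> b"
    using e l2norm_nonneg[of f] l2norm_nonneg[of g] by (auto simp: a_def b_def)
  have pointwise: "(norm (x + y))\<^sup>2 \<le> (a + b) / a * (norm x)\<^sup>2 + (a + b) / b * (norm y)\<^sup>2" for x y :: complex
  proof -
    have "0 \<le> (b * norm x - a * norm y)\<^sup>2" by simp
    then have "2 * norm x * norm y \<le> b / a * (norm x)\<^sup>2 + a / b * (norm y)\<^sup>2"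
      using ab by (simp add: field_simps power2_eq_square)
    moreover have "(norm (x + y))\<^sup>2 \<le> (norm x + norm y)\<^sup>2"
      by (intro power_mono norm_triangle_ineq) auto
    ultimately show ?thesis using ab by (simp add: add_divide_distrib power2_sum algebra_simps)
  qed
  have "(\<integral>\<omega>. (norm ((f + g) \<omega>))\<^sup>2 \<partial>M)
      \<le> (\<integral>\<omega>. (a + b) / a * (norm (f \<omega>))\<^sup>2 + (a + b) / b * (norm (g \<omega>))\<^sup>2 \<partial>M)"
    using f g pointwise
    by (intro integral_mono integrable_norm_sq[OF bounded_by_add[OF f g]] Bochner_Integration.integrable_add
        integrable_mult_right integrable_norm_sq) auto
  also have "\<dots> = (a + b) / a * (l2norm f)\<^sup>2 + (a + b) / b * (l2norm g)\<^sup>2"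
    unfolding l2norm_sq using f g by (subst Bochner_Integration.integral_add)
      (auto intro!: integrable_mult_right integrable_norm_sq)
  also have "\<dots> \<le> (a + b) / a * a\<^sup>2 + (a + b) / b * b\<^sup>2"
    using ab l2norm_nonneg by (intro add_mono mult_left_mono power_mono) auto
  also have "\<dots> = (a + b)\<^sup>2" using ab by (simp add: field_simps power2_eq_square)
  finally have "l2norm (f + g) \<le> a + b"
    unfolding l2norm_def[of "f + g"] using ab by (intro real_le_lsqrt) auto
  then show "l2norm (f + g) \<le> l2norm f + l2norm g + e" by (simp add: a_def b_def)
qed

lemma l2norm_uminus: "l2norm (- f) = l2norm f"
  by (simp add: l2norm_def)

lemma l2norm_diff_commute: "l2norm (f - g) = l2norm (g - f)"
  by (simp add: l2norm_def norm_minus_commute)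

lemma l2norm_zero [simp]: "l2norm (\<lambda>_. 0) = 0"
  by (simp add: l2norm_def)

lemma l2norm_triangle_diff:
  assumes "f \<in> bounded_by C" "g \<in> bounded_by D"
  shows "l2norm (f - g) \<le> l2norm f + l2norm g"
proof -
  have "- g \<in> bounded_by D" using assms(2) by (auto simp: bounded_by_def fun_Compl_def)
  then show ?thesis using l2norm_triangle[OF assms(1), of "- g" D] by (simp add: l2norm_uminus)
qed

lemma l2norm_dist_triangle:
  assumes "f \<in> bounded_by C" "g \<in> bounded_by D" "h \<in> bounded_by E"
  shows "l2norm (f - h) \<le> l2norm (f - g) + l2norm (g - h)"
  using l2norm_triangle[OF bounded_by_diff[OF assms(1,2)] bounded_by_diff[OF assms(2,3)]] by simp

lemma l2norm_sum:
  assumes "finite I" "\<And>i. i \<in> I \<Longrightarrow> f i \<in> bounded_by (C i)"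
  shows "l2norm (\<lambda>\<omega>. \<Sum>i\<in>I. f i \<omega>) \<le> (\<Sum>i\<in>I. l2norm (f i))"
  using assms
proof (induction I)
  case empty
  then show ?case by simp
next
  case (insert i I)
  have "l2norm (f i + (\<lambda>\<omega>. \<Sum>i\<in>I. f i \<omega>)) \<le> l2norm (f i) + l2norm (\<lambda>\<omega>. \<Sum>i\<in>I. f i \<omega>)"
    using insert by (intro l2norm_triangle[OF _ bounded_by_sum]) auto
  also have "f i + (\<lambda>\<omega>. \<Sum>i\<in>I. f i \<omega>) = (\<lambda>\<omega>. \<Sum>i\<in>insert i I. f i \<omega>)"
    using insert.hyps by (auto simp: fun_eq_iff)
  finally show ?case using insert by auto
qed

section \<open>Uniform metastability\<close>

definition steady :: "real \<Rightarrow> nat \<Rightarrow> nat \<Rightarrow> (nat \<Rightarrow> 'a \<Rightarrow> complex) \<Rightarrow> bool" where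
  "steady \<epsilon> s t a \<longleftrightarrow> (\<forall>N\<in>{s..t}. \<forall>N'\<in>{s..t}. l2norm (a N - a N') \<le> \<epsilon>)"

text \<open>
  The order of the quantifiers is essential: the number \<open>K\<close> of scales precedes the growth function \<open>F\<close>,
  whereas the scales themselves may depend on it. The lower bound \<open>L\<close> allows one family to be
  examined far beyond the scales that are needed for another one.
\<close>
definition metastable :: "(nat \<Rightarrow> 'a \<Rightarrow> complex) set \<Rightarrow> bool" where
  "metastable \<A> \<longleftrightarrow> (\<forall>\<epsilon>>0. \<exists>K. \<forall>F L. \<exists>T. finite T \<and> card T \<le> K \<and> (\<forall>t\<in>T. L \<le> t) \<and>
     (\<forall>a\<in>\<A>. \<exists>t\<in>T. steady \<epsilon> t (F t) a))"

lemma steady_subinterval: "steady \<epsilon> s t a \<Longrightarrow> s \<le> s' \<Longrightarrow> t' \<le> t \<Longrightarrow> steady \<epsilon> s' t' a"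
  unfolding steady_def by (meson atLeastAtMost_iff order_trans)

lemma metastable_Cauchy:
  assumes "metastable \<A>" "a \<in> \<A>" "0 < \<epsilon>"
  shows "\<exists>t. \<forall>N\<ge>t. \<forall>N'\<ge>t. l2norm (a N - a N') \<le> \<epsilon>"
proof (rule ccontr)
  assume "\<not> ?thesis"
  then obtain n n' where n: "\<And>t. t \<le> n t \<and> t \<le> n' t \<and> \<not> l2norm (a (n t) - a (n' t)) \<le> \<epsilon>"
    by metis
  obtain K where "\<forall>F L. \<exists>T. finite T \<and> card T \<le> K \<and> (\<forall>t\<in>T. L \<le> t) \<and>
     (\<forall>b\<in>\<A>. \<exists>t\<in>T. steady \<epsilon> t (F t) b)"
    using assms(1)[unfolded metastable_def, rule_format, OF assms(3)] ..
  from this[rule_format, of 0 "\<lambda>t. max (n t) (n' t)"] obtain t where "steady \<epsilon> t (max (n t) (n' t)) a"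
    using assms(2) by blast
  then show False using n[of t] unfolding steady_def by auto
qed

text \<open>
  Mixtures are represented by lists of weighted sequences, so that the sum of two mixtures is the
  concatenation of the lists.
\<close>
definition mass :: "(real \<times> (nat \<Rightarrow> 'a \<Rightarrow> complex)) list \<Rightarrow> real" where
  "mass ws = (\<Sum>(w, a)\<leftarrow>ws. w)"

definition combine :: "(real \<times> (nat \<Rightarrow> 'a \<Rightarrow> complex)) list \<Rightarrow> nat \<Rightarrow> 'a \<Rightarrow> complex" where
  "combine ws N \<omega> = (\<Sum>(w, a)\<leftarrow>ws. of_real w * a N \<omega>)"

definition weighted_on :: "(nat \<Rightarrow> 'a \<Rightarrow> complex) set \<Rightarrow> (real \<times> (nat \<Rightarrow> 'a \<Rightarrow> complex)) list set" where
  "weighted_on \<A> = lists ({0..} \<times> \<A>)"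

definition mixtures :: "real \<Rightarrow> (nat \<Rightarrow> 'a \<Rightarrow> complex) set \<Rightarrow> (nat \<Rightarrow> 'a \<Rightarrow> complex) set" where
  "mixtures C \<A> = combine ` {ws \<in> weighted_on \<A>. mass ws \<le> C}"

lemma mass_simps [simp]: "mass [] = 0" "mass ((w, a) # ws) = w + mass ws" "mass (ws @ vs) = mass ws + mass vs"
  by (simp_all add: mass_def)

lemma combine_simps:
  "combine [] N = (\<lambda>_. 0)"
  "combine ((w, a) # ws) N = (\<lambda>\<omega>. of_real w * a N \<omega>) + combine ws N"
  "combine (ws @ vs) N = combine ws N + combine vs N"
  by (simp_all add: combine_def fun_eq_iff)

lemma weighted_on_simps [simp]:
  "[] \<in> weighted_on \<A>" "(w, a) # ws \<in> weighted_on \<A> \<longleftrightarrow> 0 \<le> w \<and> a \<in> \<A> \<and> ws \<in> weighted_on \<A>"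
  "ws @ vs \<in> weighted_on \<A> \<longleftrightarrow> ws \<in> weighted_on \<A> \<and> vs \<in> weighted_on \<A>"
  by (auto simp: weighted_on_def)

lemma weighted_on_filter: "ws \<in> weighted_on \<A> \<Longrightarrow> filter P ws \<in> weighted_on \<A>"
  by (auto simp: weighted_on_def)

lemma mass_nonneg: "ws \<in> weighted_on \<A> \<Longrightarrow> 0 \<le> mass ws"
  by (induction ws) auto

lemma mass_filter_split: "mass ws = mass (filter P ws) + mass (filter (\<lambda>x. \<not> P x) ws)"
  by (induction ws) auto

lemma combine_bounded:
  assumes "ws \<in> weighted_on \<A>" "\<And>a. a \<in> \<A> \<Longrightarrow> a N \<in> bounded_by 1"
  shows "combine ws N \<in> bounded_by (mass ws)"
  using assms(1)
proof (induction ws)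
  case Nil
  then show ?case by (simp add: combine_simps bounded_by_const)
next
  case (Cons x ws)
  obtain w a where x: "x = (w, a)" by (cases x)
  have "(\<lambda>\<omega>. of_real w * a N \<omega>) \<in> bounded_by (w * 1)"
    using Cons.prems assms(2)[of a] by (intro bounded_by_mult bounded_by_const) (auto simp: x)
  then have "(\<lambda>\<omega>. of_real w * a N \<omega>) \<in> bounded_by w" by simp
  moreover have "combine ws N \<in> bounded_by (mass ws)" using Cons by (simp add: x)
  ultimately show ?case unfolding x combine_simps mass_simps by (rule bounded_by_add)
qed

text \<open>
  Members that are steady on \<open>[s, t]\<close> contribute \<open>\<epsilon>\<close> times their mass, the others at most twice
  their mass because they are bounded by \<open>1\<close>.
\<close>
lemma combine_oscillation:
  assumes ws: "ws \<in> weighted_on \<A>" and bounded: "\<And>a N. a \<in> \<A> \<Longrightarrow> a N \<in> bounded_by 1"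
    and NN': "N \<in> {s..t}" "N' \<in> {s..t}" and "0 \<le> \<epsilon>"
  shows "l2norm (combine ws N - combine ws N') \<le> \<epsilon> * mass ws + 2 * mass (filter (\<lambda>(w, a). \<not> steady \<epsilon> s t a) ws)"
  using ws
proof (induction ws)
  case Nil
  then show ?case by (simp add: combine_simps fun_diff_def)
next
  case (Cons x ws)
  obtain w a where x: "x = (w, a)" by (cases x)
  have wa: "0 \<le> w" "a \<in> \<A>" "ws \<in> weighted_on \<A>" using Cons.prems by (auto simp: x)
  have b: "a N - a N' \<in> bounded_by (1 + 1)" by (intro bounded_by_diff bounded wa)
  have "combine (x # ws) N - combine (x # ws) N'
      = (\<lambda>\<omega>. of_real w * (a N - a N') \<omega>) + (combine ws N - combine ws N')"
    by (auto simp: x combine_simps fun_eq_iff algebra_simps)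
  then have 1: "l2norm (combine (x # ws) N - combine (x # ws) N')
      \<le> l2norm (\<lambda>\<omega>. of_real w * (a N - a N') \<omega>) + l2norm (combine ws N - combine ws N')"
    by (simp only:) (rule l2norm_triangle[OF bounded_by_mult[OF bounded_by_const[OF order_refl] b]
          bounded_by_diff[OF combine_bounded[OF wa(3) bounded] combine_bounded[OF wa(3) bounded]]])
  have 2: "l2norm (\<lambda>\<omega>. of_real w * (a N - a N') \<omega>) = w * l2norm (a N - a N')"
    using wa unfolding l2norm_scale by (simp del: minus_apply)
  have 3: "w * l2norm (a N - a N') \<le> w * \<epsilon> + 2 * mass (filter (\<lambda>(w, a). \<not> steady \<epsilon> s t a) [x])"
  proof (cases "steady \<epsilon> s t a")
    case True
    then show ?thesis using NN' wa unfolding steady_def x by (auto intro: mult_left_mono)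
  next
    case False
    have "w * l2norm (a N - a N') \<le> w * 2" using l2norm_le[OF b] wa by (intro mult_left_mono) auto
    moreover have "0 \<le> w * \<epsilon>" using wa assms(5) by simp
    ultimately show ?thesis using False by (simp add: x)
  qed
  have "\<epsilon> * mass (x # ws) + 2 * mass (filter (\<lambda>(w, a). \<not> steady \<epsilon> s t a) (x # ws))
      = w * \<epsilon> + 2 * mass (filter (\<lambda>(w, a). \<not> steady \<epsilon> s t a) [x])
        + (\<epsilon> * mass ws + 2 * mass (filter (\<lambda>(w, a). \<not> steady \<epsilon> s t a) ws))"
    by (simp add: x algebra_simps)
  then show ?case using 1 2 3 Cons.IH[OF wa(3)] by linarith
qed

lemma weighted_pigeonhole:
  assumes ws: "ws \<in> weighted_on \<A>" and T: "finite T" "T \<noteq> {}"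
    and cover: "\<And>a. a \<in> \<A> \<Longrightarrow> \<exists>t\<in>T. P t a"
  shows "\<exists>t\<in>T. mass ws \<le> card T * mass (filter (\<lambda>(w, a). P t a) ws)"
proof (rule ccontr)
  assume "\<not> ?thesis"
  then have "\<And>t. t \<in> T \<Longrightarrow> card T * mass (filter (\<lambda>(w, a). P t a) ws) < mass ws" by auto
  then have "(\<Sum>t\<in>T. card T * mass (filter (\<lambda>(w, a). P t a) ws)) < (\<Sum>t\<in>T. mass ws)"
    using T by (intro sum_strict_mono) auto
  then have "card T * (\<Sum>t\<in>T. mass (filter (\<lambda>(w, a). P t a) ws)) < card T * mass ws"
    by (simp add: sum_distrib_left)
  then have "(\<Sum>t\<in>T. mass (filter (\<lambda>(w, a). P t a) ws)) < mass ws"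
    by (simp add: mult_less_cancel_left)
  moreover have "mass ws \<le> (\<Sum>t\<in>T. mass (filter (\<lambda>(w, a). P t a) ws))"
    using ws
  proof (induction ws)
    case Nil
    then show ?case by simp
  next
    case (Cons x ws)
    obtain w a where x: "x = (w, a)" by (cases x)
    have wa: "0 \<le> w" "a \<in> \<A>" "ws \<in> weighted_on \<A>" using Cons.prems by (auto simp: x)
    obtain t where t: "t \<in> T" "P t a" using cover[OF wa(2)] by blast
    have "w \<le> (\<Sum>t\<in>T. if P t a then w else 0)"
      using member_le_sum[of t T "\<lambda>t. if P t a then w else 0"] t T wa by simp
    then have "w + mass ws \<le> (\<Sum>t\<in>T. (if P t a then w else 0) + mass (filter (\<lambda>(w, a). P t a) ws))"
      using Cons.IH[OF wa(3)] by (simp add: sum.distrib)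
    also have "\<dots> = (\<Sum>t\<in>T. mass (filter (\<lambda>(w, a). P t a) (x # ws)))"
      by (intro sum.cong) (auto simp: x)
    finally show ?case by (simp add: x)
  qed
  ultimately show False by simp
qed

text \<open>
  Each round captures a fraction \<open>1 / K\<close> of the mass that is still unsteady. In order that the members
  captured so far stay captured, the rounds are nested: the earlier rounds are played with a growth
  function \<open>F'\<close> so large that \<open>[t, F' t]\<close> contains all intervals \<open>[t', F t']\<close> among which the last
  round chooses.
\<close>
lemma mostly_steady:
  assumes K: "0 < K" and T: "\<And>F L. finite (T F L) \<and> T F L \<noteq> {} \<and> card (T F L) \<le> K \<and> (\<forall>t\<in>T F L. L \<le> t) \<and>
     (\<forall>a\<in>\<A>. \<exists>t\<in>T F L. steady \<epsilon> t (F t) a)"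
  shows "\<exists>U. finite U \<and> card U \<le> K ^ R \<and> (\<forall>t\<in>U. L \<le> t) \<and>
     (\<forall>ws\<in>weighted_on \<A>. \<exists>t\<in>U. mass (filter (\<lambda>(w, a). \<not> steady \<epsilon> t (F t) a) ws) \<le> (1 - 1 / K) ^ R * mass ws)"
proof (induction R arbitrary: F L)
  case 0
  have "mass (filter P ws) \<le> mass ws" if "ws \<in> weighted_on \<A>" for ws P
    using mass_filter_split[of ws P] mass_nonneg[OF weighted_on_filter[OF that]] by (simp add: algebra_simps)
  then show ?case by (intro exI[of _ "{L}"]) auto
next
  case (Suc R)
  define F' where "F' = (\<lambda>t. Max (F ` T F t))"
  obtain U where U: "finite U" "card U \<le> K ^ R" "\<And>t. t \<in> U \<Longrightarrow> L \<le> t"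
    "\<And>ws. ws \<in> weighted_on \<A> \<Longrightarrow> \<exists>t\<in>U. mass (filter (\<lambda>(w, a). \<not> steady \<epsilon> t (F' t) a) ws) \<le> (1 - 1 / K) ^ R * mass ws"
    using Suc.IH[of L F'] by blast
  define V where "V = (\<Union>u\<in>U. T F u)"
  have "card V \<le> (\<Sum>u\<in>U. card (T F u))" unfolding V_def by (rule card_UN_le[OF U(1)])
  also have "\<dots> \<le> card U * K" using T sum_bounded_above[of U "\<lambda>u. card (T F u)" K] by auto
  also have "\<dots> \<le> K ^ Suc R" using U(2) by simp
  finally have card: "card V \<le> K ^ Suc R" .
  have "\<exists>t\<in>V. mass (filter (\<lambda>(w, a). \<not> steady \<epsilon> t (F t) a) ws) \<le> (1 - 1 / K) ^ Suc R * mass ws"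
    if ws: "ws \<in> weighted_on \<A>" for ws
  proof -
    obtain u where u: "u \<in> U" "mass (filter (\<lambda>(w, a). \<not> steady \<epsilon> u (F' u) a) ws) \<le> (1 - 1 / K) ^ R * mass ws"
      using U(4)[OF ws] by blast
    define vs where "vs = filter (\<lambda>(w, a). \<not> steady \<epsilon> u (F' u) a) ws"
    have vs: "vs \<in> weighted_on \<A>" unfolding vs_def by (rule weighted_on_filter[OF ws])
    obtain t where t: "t \<in> T F u" "mass vs \<le> card (T F u) * mass (filter (\<lambda>(w, a). steady \<epsilon> t (F t) a) vs)"
      using weighted_pigeonhole[OF vs, of "T F u" "\<lambda>t. steady \<epsilon> t (F t)"] T by blast
    have "card (T F u) * mass (filter (\<lambda>(w, a). steady \<epsilon> t (F t) a) vs)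
        \<le> K * mass (filter (\<lambda>(w, a). steady \<epsilon> t (F t) a) vs)"
      using T mass_nonneg[OF weighted_on_filter[OF vs]] by (intro mult_right_mono) auto
    then have good: "mass vs / K \<le> mass (filter (\<lambda>(w, a). steady \<epsilon> t (F t) a) vs)"
      using t(2) K by (simp add: field_simps)
    have "F t \<le> F' u" "u \<le> t" using T t(1) by (auto simp: F'_def)
    then have "filter (\<lambda>(w, a). \<not> steady \<epsilon> t (F t) a) ws = filter (\<lambda>(w, a). \<not> steady \<epsilon> t (F t) a) vs"
      unfolding vs_def filter_filter by (intro filter_cong) (auto dest: steady_subinterval)
    also have "mass \<dots> = mass vs - mass (filter (\<lambda>(w, a). steady \<epsilon> t (F t) a) vs)"
      using mass_filter_split[of vs "\<lambda>(w, a). steady \<epsilon> t (F t) a"]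
      by (simp add: case_prod_unfold)
    also have "\<dots> \<le> (1 - 1 / K) * mass vs" using good by (simp add: algebra_simps)
    also have "\<dots> \<le> (1 - 1 / K) * ((1 - 1 / K) ^ R * mass ws)"
      using u(2) K unfolding vs_def by (intro mult_left_mono) auto
    finally show ?thesis using u(1) t(1) by (auto simp: V_def mult.assoc)
  qed
  moreover have "L \<le> t" if "t \<in> V" for t using that U(3) T by (fastforce simp: V_def intro: order_trans)
  moreover have "finite V" using U(1) T by (auto simp: V_def)
  ultimately show ?case using card by blast
qed

text \<open>
  After enough rounds the unsteady mass is negligible. The number of rounds depends only on \<open>K\<close>, \<open>C\<close>
  and \<open>\<epsilon>\<close>, hence so does the number of candidate scales; this is where it matters that \<open>K\<close> does not
  depend on the growth function.
\<close>
lemma metastable_mixtures: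
  assumes meta: "metastable \<A>" and bounded: "\<And>a N. a \<in> \<A> \<Longrightarrow> a N \<in> bounded_by 1"
  shows "metastable (mixtures C \<A>)"
  unfolding metastable_def
proof (intro allI impI)
  fix \<epsilon> :: real assume \<epsilon>: "0 < \<epsilon>"
  define D where "D = max C 1"
  define \<delta> where "\<delta> = \<epsilon> / (2 * D)"
  have D: "D \<ge> 1" "C \<le> D" "\<delta> > 0" using \<epsilon> by (auto simp: D_def \<delta>_def)
  obtain K where K: "\<forall>F L. \<exists>T. finite T \<and> card T \<le> K \<and> (\<forall>t\<in>T. L \<le> t) \<and> (\<forall>a\<in>\<A>. \<exists>t\<in>T. steady \<delta> t (F t) a)"
    using meta[unfolded metastable_def, rule_format, OF D(3)] ..
  define good where "good = (\<lambda>F L T. finite T \<and> T \<noteq> {} \<and> card T \<le> Suc K \<and> (\<forall>t\<in>T. L \<le> t) \<and>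
    (\<forall>a\<in>\<A>. \<exists>t\<in>T. steady \<delta> t (F t) a))"
  define T where "T = (\<lambda>F L. SOME U. good F L U)"
  have "good F L (T F L)" for F L
  proof -
    obtain U where U: "finite U" "card U \<le> K" "\<forall>t\<in>U. L \<le> t" "\<forall>a\<in>\<A>. \<exists>t\<in>U. steady \<delta> t (F t) a"
      using spec[OF spec[OF K, of F], of L] by blast
    then have "card (insert L U) \<le> Suc K" by (simp add: card_insert_if)
    then have "good F L (insert L U)" using U by (auto simp: good_def)
    then show ?thesis unfolding T_def by (rule someI)
  qed
  then have T: "\<And>F L. finite (T F L) \<and> T F L \<noteq> {} \<and> card (T F L) \<le> Suc K \<and> (\<forall>t\<in>T F L. L \<le> t) \<and>
     (\<forall>a\<in>\<A>. \<exists>t\<in>T F L. steady \<delta> t (F t) a)"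
    unfolding good_def .
  have "(\<lambda>R. (1 - 1 / real (Suc K)) ^ R) \<longlonglongrightarrow> 0"
    by (intro LIMSEQ_power_zero) (auto simp: field_simps)
  moreover have "\<epsilon> / (4 * D) > 0" using \<epsilon> D by simp
  ultimately obtain R where R: "(1 - 1 / real (Suc K)) ^ R < \<epsilon> / (4 * D)"
    by (metis (no_types, lifting) order_tendstoD(2) eventually_sequentially order_refl)
  show "\<exists>K. \<forall>F L. \<exists>T. finite T \<and> card T \<le> K \<and> (\<forall>t\<in>T. L \<le> t) \<and> (\<forall>a\<in>mixtures C \<A>. \<exists>t\<in>T. steady \<epsilon> t (F t) a)"
  proof (intro exI[of _ "Suc K ^ R"] allI)
    fix F L
    obtain U where U: "finite U" "card U \<le> Suc K ^ R" "\<forall>t\<in>U. L \<le> t"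
      "\<And>ws. ws \<in> weighted_on \<A> \<Longrightarrow> \<exists>t\<in>U. mass (filter (\<lambda>(w, a). \<not> steady \<delta> t (F t) a) ws) \<le> (1 - 1 / Suc K) ^ R * mass ws"
      using mostly_steady[OF zero_less_Suc T, of R L F] by blast
    have "\<exists>t\<in>U. steady \<epsilon> t (F t) (combine ws)" if ws: "ws \<in> weighted_on \<A>" "mass ws \<le> C" for ws
    proof -
      obtain t where t: "t \<in> U" "mass (filter (\<lambda>(w, a). \<not> steady \<delta> t (F t) a) ws) \<le> (1 - 1 / Suc K) ^ R * mass ws"
        using U(4)[OF ws(1)] by blast
      have "(1 - 1 / Suc K) ^ R * mass ws \<le> \<epsilon> / (4 * D) * D"
        using R ws D \<epsilon> mass_nonneg[OF ws(1)] by (intro mult_mono) auto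
      then have bad: "2 * mass (filter (\<lambda>(w, a). \<not> steady \<delta> t (F t) a) ws) \<le> \<epsilon> / 2" using t(2) D by simp
      have "\<delta> * mass ws \<le> \<delta> * D" using D ws by (intro mult_left_mono) auto
      then have good: "\<delta> * mass ws \<le> \<epsilon> / 2" using D by (simp add: \<delta>_def)
      have "steady \<epsilon> t (F t) (combine ws)"
        unfolding steady_def
      proof (intro ballI)
        fix N N' assume "N \<in> {t..F t}" "N' \<in> {t..F t}"
        then have "l2norm (combine ws N - combine ws N')
            \<le> \<delta> * mass ws + 2 * mass (filter (\<lambda>(w, a). \<not> steady \<delta> t (F t) a) ws)"
          by (intro combine_oscillation[OF ws(1)] bounded) (use D(3) in auto)
        with bad good show "l2norm (combine ws N - combine ws N') \<le> \<epsilon>" by linarith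
      qed
      then show ?thesis using t(1) by blast
    qed
    then show "\<exists>T. finite T \<and> card T \<le> Suc K ^ R \<and> (\<forall>t\<in>T. L \<le> t) \<and> (\<forall>a\<in>mixtures C \<A>. \<exists>t\<in>T. steady \<epsilon> t (F t) a)"
      using U(1-3) unfolding mixtures_def by blast
  qed
qed

end

section \<open>Products along integer sequences\<close>

locale int_action = prob_space M for M :: "'a measure" +
  fixes S :: "int \<Rightarrow> 'a \<Rightarrow> 'a"
  assumes S_measurable: "S m \<in> measurable M M"
    and S_zero: "\<omega> \<in> space M \<Longrightarrow> S 0 \<omega> = \<omega>"
    and S_add: "\<omega> \<in> space M \<Longrightarrow> S (j + k) \<omega> = S j (S k \<omega>)"
    and S_preserving: "distr M M (S m) = M"
begin

lemma S_space: "\<omega> \<in> space M \<Longrightarrow> S m \<omega> \<in> space M"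
  using measurable_space[OF S_measurable] .

lemma bounded_by_S: "f \<in> bounded_by C \<Longrightarrow> (\<lambda>\<omega>. f (S m \<omega>)) \<in> bounded_by C"
  using S_measurable[of m] S_space by (auto simp: bounded_by_def)

lemma integral_S:
  fixes f :: "'a \<Rightarrow> 'b::{banach, second_countable_topology}"
  shows "f \<in> borel_measurable M \<Longrightarrow> (\<integral>\<omega>. f (S m \<omega>) \<partial>M) = (\<integral>\<omega>. f \<omega> \<partial>M)"
  using integral_distr[OF S_measurable[of m], of f] by (simp add: S_preserving)

lemma l2norm_S:
  assumes "f \<in> bounded_by C"
  shows "l2norm (\<lambda>\<omega>. f (S m \<omega>)) = l2norm f"
proof -
  have [measurable]: "f \<in> borel_measurable M" using assms by (rule bounded_by_measurable)
  have "(\<lambda>\<omega>. (norm (f \<omega>))\<^sup>2) \<in> borel_measurable M" by measurable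
  from integral_S[OF this] show ?thesis by (simp add: l2norm_def)
qed

text \<open>
  The products \<open>\<xi> n \<cdot> (\<Prod>i. f\<^sub>i \<circ> S (r\<^sub>i n + c\<^sub>i))\<close> with any number of factors, with exponents from \<open>Q\<close> or
  zero up to additive constants, and with a scalar weight of period \<open>q\<close>. Repetitions, constants and the
  zero exponent are admitted so that the class is closed under multiplication and only the set \<open>Q\<close>
  modulo constants matters.
\<close>
inductive_set products :: "nat \<Rightarrow> (nat \<Rightarrow> int) set \<Rightarrow> (nat \<Rightarrow> 'a \<Rightarrow> complex) set" for q Q where
  periodic: "(\<And>n. \<xi> (n + q) = \<xi> n) \<Longrightarrow> (\<And>n. norm (\<xi> n) \<le> 1) \<Longrightarrow> (\<lambda>n \<omega>. \<xi> n) \<in> products q Q"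
| factor: "\<phi> \<in> products q Q \<Longrightarrow> r \<in> insert 0 Q \<Longrightarrow> f \<in> bounded_by 1 \<Longrightarrow>
    (\<lambda>n \<omega>. \<phi> n \<omega> * f (S (r n + c) \<omega>)) \<in> products q Q"

lemma products_bounded: "\<phi> \<in> products q Q \<Longrightarrow> \<phi> n \<in> bounded_by 1"
proof (induction arbitrary: n rule: products.induct)
  case (periodic \<xi>)
  then show ?case by (intro bounded_by_const)
next
  case (factor \<phi> r f c)
  then show ?case using bounded_by_mult[OF factor.IH bounded_by_S[OF factor.hyps(3)]] by simp
qed

lemma products_mono:
  assumes "\<phi> \<in> products q Q" "Q \<subseteq> R" shows "\<phi> \<in> products q R"
  using assms(1)
proof (induction rule: products.induct)
  case (periodic \<xi>)
  then show ?case by (rule products.periodic)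
next
  case (factor \<phi> r f c)
  show ?case by (rule products.factor) (use factor assms(2) in auto)
qed

lemma products_mult:
  assumes "\<phi> \<in> products q Q" "\<psi> \<in> products q Q"
  shows "(\<lambda>n \<omega>. \<phi> n \<omega> * \<psi> n \<omega>) \<in> products q Q"
  using assms(2)
proof (induction rule: products.induct)
  case (periodic \<xi>)
  note \<xi> = this
  show ?case using assms(1)
  proof (induction rule: products.induct)
    case (periodic \<xi>')
    have "norm (\<xi>' n * \<xi> n) \<le> 1" for n
      using mult_mono[OF periodic(2)[of n] \<xi>(2)[of n]] by (simp add: norm_mult)
    then show ?case using periodic \<xi> by (intro products.periodic) auto
  next
    case (factor \<phi> r f c)
    have "(\<lambda>n \<omega>. \<phi> n \<omega> * f (S (r n + c) \<omega>) * \<xi> n) = (\<lambda>n \<omega>. \<phi> n \<omega> * \<xi> n * f (S (r n + c) \<omega>))"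
      by (simp add: fun_eq_iff mult_ac)
    with products.factor[OF factor.IH factor.hyps(2,3), of c] show ?case by (simp only:)
  qed
next
  case (factor \<psi> r f c)
  show ?case
    using products.factor[OF factor.IH factor.hyps(2,3), of c] by (simp add: mult.assoc)
qed

lemma products_constant:
  assumes "\<phi> \<in> products q Q" "\<forall>r\<in>Q. degree_le 0 r"
  shows "\<exists>\<xi> g. (\<forall>n. \<xi> (n + q) = \<xi> n) \<and> (\<forall>n. norm (\<xi> n) \<le> 1) \<and> g \<in> bounded_by 1 \<and>
    (\<forall>n \<omega>. \<phi> n \<omega> = \<xi> n * g \<omega>)"
  using assms(1)
proof (induction rule: products.induct)
  case (periodic \<xi>)
  then show ?case
    by (intro exI[of _ \<xi>] exI[of _ "\<lambda>_. 1"]) (auto intro: bounded_by_const)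
next
  case (factor \<phi> r f c)
  then obtain \<xi> g where \<xi>: "\<forall>n. \<xi> (n + q) = \<xi> n" "\<forall>n. norm (\<xi> n) \<le> 1" "g \<in> bounded_by 1"
    "\<forall>n \<omega>. \<phi> n \<omega> = \<xi> n * g \<omega>" by blast
  have "degree_le 0 r" using factor.hyps(2) assms(2) degree_le_zero by blast
  then have r: "r n = r 0" for n by simp
  have "(\<lambda>\<omega>. g \<omega> * f (S (r 0 + c) \<omega>)) \<in> bounded_by 1"
    using bounded_by_mult[OF \<xi>(3) bounded_by_S[OF factor.hyps(3)]] by simp
  moreover have "\<forall>n \<omega>. \<phi> n \<omega> * f (S (r n + c) \<omega>) = \<xi> n * (g \<omega> * f (S (r 0 + c) \<omega>))"
    using \<xi>(4) r by (metis mult.assoc)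
  ultimately show ?case using \<xi>(1,2) by blast
qed

text \<open>
  The factors whose exponents differ from \<open>p\<close> by a constant \<open>k\<close> combine into a single function of
  \<open>S (p n) \<omega>\<close>, because \<open>S (p n + k) \<omega> = S k (S (p n) \<omega>)\<close>.
\<close>
lemma products_split:
  assumes "\<phi> \<in> products q Q"
  shows "\<exists>\<psi>\<in>products q {r \<in> Q. \<not> degree_le 0 (r - p)}. \<exists>g\<in>bounded_by 1.
    \<forall>n. \<forall>\<omega>\<in>space M. \<phi> n \<omega> = \<psi> n \<omega> * g (S (p n) \<omega>)"
  using assms
proof (induction rule: products.induct)
  case (periodic \<xi>)
  then show ?case
    by (intro bexI[of _ "\<lambda>n \<omega>. \<xi> n"] bexI[of _ "\<lambda>_. 1"] products.periodic) (auto intro: bounded_by_const)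
next
  case (factor \<phi> r f c)
  then obtain \<psi> g where \<psi>: "\<psi> \<in> products q {r \<in> Q. \<not> degree_le 0 (r - p)}" "g \<in> bounded_by 1"
    "\<forall>n. \<forall>\<omega>\<in>space M. \<phi> n \<omega> = \<psi> n \<omega> * g (S (p n) \<omega>)" by blast
  show ?case
  proof (cases "r \<in> insert 0 {r \<in> Q. \<not> degree_le 0 (r - p)}")
    case True
    have "(\<lambda>n \<omega>. \<psi> n \<omega> * f (S (r n + c) \<omega>)) \<in> products q {r \<in> Q. \<not> degree_le 0 (r - p)}"
      using \<psi>(1) True factor.hyps(3) by (rule products.factor)
    then show ?thesis
      by (rule bexI[rotated]) (use \<psi>(2,3) in \<open>auto intro!: bexI[of _ g]\<close>)
  next
    case False
    then have "degree_le 0 (r - p)" using factor.hyps(2) by blast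
    then have r: "r n = (r 0 - p 0) + p n" for n
      by (simp add: algebra_simps)
    define g' where "g' = (\<lambda>\<omega>. g \<omega> * f (S (c + (r 0 - p 0)) \<omega>))"
    have "g' \<in> bounded_by 1"
      using bounded_by_mult[OF \<psi>(2) bounded_by_S[OF factor.hyps(3)]] unfolding g'_def by simp
    moreover have "\<forall>n. \<forall>\<omega>\<in>space M. \<phi> n \<omega> * f (S (r n + c) \<omega>) = \<psi> n \<omega> * g' (S (p n) \<omega>)"
    proof (intro allI ballI)
      fix n \<omega> assume \<omega>: "\<omega> \<in> space M"
      have "r n + c = (c + (r 0 - p 0)) + p n" by (subst r) simp
      then have "S (r n + c) \<omega> = S (c + (r 0 - p 0)) (S (p n) \<omega>)" using S_add[OF \<omega>] by metis
      then show "\<phi> n \<omega> * f (S (r n + c) \<omega>) = \<psi> n \<omega> * g' (S (p n) \<omega>)"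
        using \<psi>(3) \<omega> by (simp add: g'_def)
    qed
    ultimately show ?thesis using \<psi>(1) by blast
  qed
qed

text \<open>
  Reading \<open>\<psi>\<close> at time \<open>l + m\<close> from the point \<open>S (p l - p (l + m)) \<omega>\<close> produces the new exponents in the
  definition of \<open>descendants\<close>.
\<close>
lemma products_shift:
  assumes "\<psi> \<in> products q R"
  shows "\<exists>\<psi>'\<in>products q (insert (- shift_diff m p) ((\<lambda>r. r + shift_diff m (r - p)) ` R)).
    \<forall>l. \<forall>\<omega>\<in>space M. cnj (\<psi> (l + m) (S (p l - p (l + m)) \<omega>)) = \<psi>' l \<omega>"
  using assms
proof (induction rule: products.induct)
  case (periodic \<xi>)
  have "(\<lambda>l \<omega>. cnj (\<xi> (l + m))) \<in> products q (insert (- shift_diff m p) ((\<lambda>r. r + shift_diff m (r - p)) ` R))"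
    using periodic(1)[of "_ + m"] periodic(2) by (intro products.periodic) (simp_all add: add.commute add.left_commute)
  then show ?case by (rule bexI[rotated]) simp
next
  case (factor \<psi> r f c)
  let ?Q = "insert (- shift_diff m p) ((\<lambda>r. r + shift_diff m (r - p)) ` R)"
  obtain \<psi>' where \<psi>': "\<psi>' \<in> products q ?Q"
    "\<forall>l. \<forall>\<omega>\<in>space M. cnj (\<psi> (l + m) (S (p l - p (l + m)) \<omega>)) = \<psi>' l \<omega>"
    using factor.IH by blast
  define r' where "r' = r + shift_diff m (r - p)"
  have r': "r' \<in> insert 0 ?Q"
  proof (cases "r = 0")
    case True
    have "r' = - shift_diff m p" by (auto simp: r'_def True fun_eq_iff shift_diff_def)
    then show ?thesis by simp
  next
    case False
    then show ?thesis using factor.hyps(2) by (auto simp: r'_def)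
  qed
  have eq: "cnj (\<psi> (l + m) (S (p l - p (l + m)) \<omega>) * f (S (r (l + m) + c) (S (p l - p (l + m)) \<omega>)))
      = \<psi>' l \<omega> * cnj (f (S (r' l + c) \<omega>))" if "\<omega> \<in> space M" for l \<omega>
  proof -
    have e: "(r (l + m) + c) + (p l - p (l + m)) = r' l + c"
      by (simp add: r'_def shift_diff_def)
    have "S (r (l + m) + c) (S (p l - p (l + m)) \<omega>) = S (r' l + c) \<omega>"
      unfolding e[symmetric] by (rule S_add[OF that, symmetric])
    then show ?thesis using \<psi>'(2) that by simp
  qed
  have "(\<lambda>l \<omega>. \<psi>' l \<omega> * cnj (f (S (r' l + c) \<omega>))) \<in> products q ?Q"
    using products.factor[OF \<psi>'(1) r' bounded_by_cnj[OF factor.hyps(3)], of c] .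
  then show ?case by (rule bexI[rotated]) (use eq in blast)
qed

definition avg :: "nat \<Rightarrow> (nat \<Rightarrow> 'a \<Rightarrow> complex) \<Rightarrow> 'a \<Rightarrow> complex" where
  "avg N \<phi> \<omega> = (\<Sum>n=1..N. \<phi> n \<omega>) / of_nat N"

lemma avg_bounded:
  assumes "\<And>n. \<phi> n \<in> bounded_by C"
  shows "avg N \<phi> \<in> bounded_by C"
proof (cases "N = 0")
  case True
  then show ?thesis using bounded_by_nonneg[OF assms] bounded_by_const[of 0 C] by (simp add: avg_def[abs_def])
next
  case False
  have "(\<lambda>\<omega>. (1 / of_nat N) * (\<Sum>n=1..N. \<phi> n \<omega>)) \<in> bounded_by ((1 / real N) * (\<Sum>n=1..N. C))"
    by (intro bounded_by_mult bounded_by_const bounded_by_sum assms) (simp add: norm_divide)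
  then show ?thesis using False by (simp add: avg_def[abs_def])
qed

lemma l2norm_avg_le:
  assumes "\<And>n. \<phi> n \<in> bounded_by C" "\<And>n. l2norm (\<phi> n) \<le> c" "0 \<le> c"
  shows "l2norm (avg N \<phi>) \<le> c"
proof (cases "N = 0")
  case True
  then show ?thesis using assms(3) by (simp add: avg_def[abs_def])
next
  case False
  have "avg N \<phi> = (\<lambda>\<omega>. (1 / of_nat N) * (\<Sum>n=1..N. \<phi> n \<omega>))" by (simp add: avg_def[abs_def])
  then have "l2norm (avg N \<phi>) = norm (1 / of_nat N :: complex) * l2norm (\<lambda>\<omega>. \<Sum>n=1..N. \<phi> n \<omega>)"
    by (simp only: l2norm_scale)
  also have "norm (1 / of_nat N :: complex) = 1 / real N" by (simp add: norm_divide)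
  also have "1 / real N * l2norm (\<lambda>\<omega>. \<Sum>n=1..N. \<phi> n \<omega>) \<le> (1 / real N) * (\<Sum>n=1..N. l2norm (\<phi> n))"
    by (intro mult_left_mono l2norm_sum[where C = "\<lambda>_. C"] assms) auto
  also have "\<dots> \<le> (1 / real N) * (\<Sum>n=1..N. c)"
    by (intro mult_left_mono sum_mono assms) auto
  also have "\<dots> = c" using False by simp
  finally show ?thesis .
qed

text \<open>
  All systems of a given complexity over all bounded functions at once: metastability of this set is
  metastability uniform in the system, in the functions and in the weight of period \<open>q\<close>.
\<close>
definition averages :: "nat \<Rightarrow> nat \<Rightarrow> (nat \<Rightarrow> 'a \<Rightarrow> complex) set" where
  "averages q d = {\<lambda>N. avg N \<phi> | \<phi> Q. \<phi> \<in> products q Q \<and> complexity_le d Q}"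

lemma averages_bounded: "a \<in> averages q d \<Longrightarrow> a N \<in> bounded_by 1"
  using products_bounded by (auto simp: averages_def intro!: avg_bounded)

section \<open>Periodic weights with constant exponents\<close>

text \<open>
  With \<open>c\<close> the mean over one period, the deviation of the \<open>N\<close>-th partial sum from \<open>N c\<close> is itself
  periodic in \<open>N\<close>.
\<close>
lemma periodic_mean:
  fixes \<xi> :: "nat \<Rightarrow> complex"
  assumes q: "1 \<le> q" and per: "\<And>n. \<xi> (n + q) = \<xi> n" and bound: "\<And>n. norm (\<xi> n) \<le> 1"
  shows "\<exists>c. \<forall>N. norm ((\<Sum>n=1..N. \<xi> n) - of_nat N * c) \<le> 2 * real q"
proof -
  define c where "c = (\<Sum>n=1..q. \<xi> n) / of_nat q"
  define E where "E = (\<lambda>N. (\<Sum>n=1..N. \<xi> n) - of_nat N * c)"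
  have period: "(\<Sum>n=1..N+q. \<xi> n) = (\<Sum>n=1..N. \<xi> n) + of_nat q * c" for N
  proof (induction N)
    case 0
    then show ?case using q by (simp add: c_def)
  next
    case (Suc N)
    then show ?case using per[of "Suc N"] by simp
  qed
  have E_period: "E (N + q) = E N" for N by (simp only: E_def period of_nat_add distrib_right) simp
  have c: "norm c \<le> 1"
    using sum_norm_le[of "{1..q}" \<xi> "\<lambda>_. 1"] bound q by (simp add: c_def norm_divide divide_le_eq)
  have small: "norm (E N) \<le> 2 * real q" if "N < q" for N
  proof -
    have "norm (E N) \<le> norm (\<Sum>n=1..N. \<xi> n) + norm (of_nat N * c)" unfolding E_def by (rule norm_triangle_ineq4)
    also have "\<dots> \<le> real N + real N * 1"
      using sum_norm_le[of "{1..N}" \<xi> "\<lambda>_. 1"] bound c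
      by (intro add_mono) (auto simp: norm_mult intro: mult_left_le)
    finally show ?thesis using that by simp
  qed
  have "norm (E N) \<le> 2 * real q" for N
  proof (induction N rule: less_induct)
    case (less N)
    then show ?case using small[of N] E_period[of "N - q"] q by (cases "N < q") auto
  qed
  then show ?thesis unfolding E_def by blast
qed

text \<open>
  With constant exponents the average is a fixed function times a mean of the periodic weight. A
  single scale suffices, and it depends only on \<open>q\<close>, \<open>\<epsilon>\<close> and \<open>L\<close>.
\<close>
lemma metastable_complexity_zero:
  assumes q: "1 \<le> q"
  shows "metastable (averages q 0)"
  unfolding metastable_def
proof (intro allI impI exI[of _ "1::nat"])
  fix \<epsilon> :: real and F :: "nat \<Rightarrow> nat" and L :: nat assume \<epsilon>: "0 < \<epsilon>"
  define t where "t = max L (nat \<lceil>4 * real q / \<epsilon>\<rceil> + 1)"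
  have t: "L \<le> t" "1 \<le> t" "4 * real q / \<epsilon> \<le> real t" unfolding t_def by linarith+
  have "steady \<epsilon> t (F t) a" if a: "a \<in> averages q 0" for a
  proof -
    obtain \<phi> Q where \<phi>: "a = (\<lambda>N. avg N \<phi>)" "\<phi> \<in> products q Q" "\<forall>r\<in>Q. degree_le 0 r"
      using a by (auto simp: averages_def complexity_le_def)
    obtain \<xi> g where \<xi>: "\<And>n. \<xi> (n + q) = \<xi> n" "\<And>n. norm (\<xi> n) \<le> 1" "g \<in> bounded_by 1"
      "\<And>n \<omega>. \<phi> n \<omega> = \<xi> n * g \<omega>" using products_constant[OF \<phi>(2,3)] by blast
    obtain c where c: "\<And>N. norm ((\<Sum>n=1..N. \<xi> n) - of_nat N * c) \<le> 2 * real q"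
      using periodic_mean[of q \<xi>] q \<xi>(1,2) by blast
    have mean: "norm ((\<Sum>n=1..N. \<xi> n) / of_nat N - c) \<le> \<epsilon> / 2" if "t \<le> N" for N
    proof -
      have N: "0 < N" "4 * real q / \<epsilon> \<le> real N" using that t by linarith+
      have "(\<Sum>n=1..N. \<xi> n) / of_nat N - c = ((\<Sum>n=1..N. \<xi> n) - of_nat N * c) / of_nat N"
        using N by (simp add: diff_divide_distrib)
      then have "norm ((\<Sum>n=1..N. \<xi> n) / of_nat N - c) \<le> 2 * real q / real N"
        using c[of N] by (simp add: norm_divide divide_right_mono)
      also have "\<dots> \<le> \<epsilon> / 2" using N \<epsilon> by (simp add: field_simps)
      finally show ?thesis .
    qed
    have "l2norm (a N - a N') \<le> \<epsilon>" if NN': "t \<le> N" "t \<le> N'" for N N'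
    proof -
      define k where "k = (\<Sum>n=1..N. \<xi> n) / of_nat N - (\<Sum>n=1..N'. \<xi> n) / of_nat N'"
      have "norm k \<le> norm ((\<Sum>n=1..N. \<xi> n) / of_nat N - c) + norm ((\<Sum>n=1..N'. \<xi> n) / of_nat N' - c)"
        using norm_triangle_ineq4[of "(\<Sum>n=1..N. \<xi> n) / of_nat N - c" "(\<Sum>n=1..N'. \<xi> n) / of_nat N' - c"]
        by (simp add: k_def)
      then have k: "norm k \<le> \<epsilon>" using mean[OF NN'(1)] mean[OF NN'(2)] by linarith
      have "a N - a N' = (\<lambda>\<omega>. k * g \<omega>)"
        by (simp add: \<phi>(1) avg_def fun_eq_iff \<xi>(4) k_def algebra_simps flip: sum_distrib_right sum_distrib_left)
      then have "a N - a N' \<in> bounded_by (\<epsilon> * 1)"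
        using bounded_by_mult[OF bounded_by_const[OF k] \<xi>(3)] by simp
      then show ?thesis using l2norm_le by simp
    qed
    then show ?thesis unfolding steady_def by auto
  qed
  then show "\<exists>T. finite T \<and> card T \<le> 1 \<and> (\<forall>t\<in>T. L \<le> t) \<and> (\<forall>a\<in>averages q 0. \<exists>t\<in>T. steady \<epsilon> t (F t) a)"
    using t(1) by (intro exI[of _ "{t}"]) auto
qed

end

section \<open>Dual functions and the energy argument\<close>

context int_action
begin

definition twist :: "(nat \<Rightarrow> 'a \<Rightarrow> complex) \<Rightarrow> (nat \<Rightarrow> int) \<Rightarrow> ('a \<Rightarrow> complex) \<Rightarrow> nat \<Rightarrow> 'a \<Rightarrow> complex" where
  "twist \<psi> p u n \<omega> = \<psi> n \<omega> * u (S (p n) \<omega>)"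

text \<open>
  The adjoint of \<open>u \<mapsto> avg N (twist \<psi> p u)\<close>, applied to \<open>h\<close>.
\<close>
definition dual :: "nat \<Rightarrow> (nat \<Rightarrow> 'a \<Rightarrow> complex) \<Rightarrow> (nat \<Rightarrow> int) \<Rightarrow> ('a \<Rightarrow> complex) \<Rightarrow> 'a \<Rightarrow> complex" where
  "dual N \<psi> p h = avg N (\<lambda>n \<omega>. cnj (\<psi> n (S (- p n) \<omega>)) * h (S (- p n) \<omega>))"

lemma twist_bounded:
  assumes "\<And>n. \<psi> n \<in> bounded_by 1" "u \<in> bounded_by C"
  shows "twist \<psi> p u n \<in> bounded_by C"
  using bounded_by_mult[OF assms(1)[of n] bounded_by_S[OF assms(2), of "p n"]] by (simp add: twist_def[abs_def])

lemma l2norm_mult_le: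
  assumes "f \<in> bounded_by 1" "g \<in> bounded_by C"
  shows "l2norm (\<lambda>\<omega>. f \<omega> * g \<omega>) \<le> l2norm g"
proof (rule l2norm_mono[OF _ assms(2)])
  show "(\<lambda>\<omega>. f \<omega> * g \<omega>) \<in> borel_measurable M" using bounded_by_mult[OF assms] by (rule bounded_by_measurable)
  show "norm (f \<omega> * g \<omega>) \<le> norm (g \<omega>)" if "\<omega> \<in> space M" for \<omega>
    using bounded_byD[OF assms(1) that] mult_right_mono[of "norm (f \<omega>)" 1 "norm (g \<omega>)"] by (simp add: norm_mult)
qed

lemma dual_term_bounded:
  assumes "\<And>n. \<psi> n \<in> bounded_by 1" "h \<in> bounded_by C"
  shows "(\<lambda>\<omega>. cnj (\<psi> n (S (- p n) \<omega>)) * h (S (- p n) \<omega>)) \<in> bounded_by C"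
  using bounded_by_mult[OF bounded_by_cnj[OF bounded_by_S[OF assms(1)[of n], of "- p n"]] bounded_by_S[OF assms(2), of "- p n"]]
  by simp

lemma dual_bounded:
  assumes "\<And>n. \<psi> n \<in> bounded_by 1" "h \<in> bounded_by C"
  shows "dual N \<psi> p h \<in> bounded_by C"
  unfolding dual_def using dual_term_bounded[OF assms] by (rule avg_bounded)

lemma l2norm_dual:
  assumes "\<And>n. \<psi> n \<in> bounded_by 1" "h \<in> bounded_by C"
  shows "l2norm (dual N \<psi> p h) \<le> l2norm h"
  unfolding dual_def
proof (rule l2norm_avg_le[OF dual_term_bounded[OF assms]])
  show "l2norm (\<lambda>\<omega>. cnj (\<psi> n (S (- p n) \<omega>)) * h (S (- p n) \<omega>)) \<le> l2norm h" for n
    using l2norm_mult_le[OF bounded_by_cnj[OF bounded_by_S[OF assms(1)[of n], of "- p n"]] bounded_by_S[OF assms(2), of "- p n"]]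
      l2norm_S[OF assms(2), of "- p n"] by simp
qed (rule l2norm_nonneg)

lemma integral_twist_dual:
  assumes \<psi>: "\<And>n. \<psi> n \<in> bounded_by 1" and u: "u \<in> bounded_by C" and h: "h \<in> bounded_by D"
  shows "(\<integral>\<omega>. u \<omega> * cnj (dual N \<psi> p h \<omega>) \<partial>M) = (\<integral>\<omega>. avg N (twist \<psi> p u) \<omega> * cnj (h \<omega>) \<partial>M)"
proof -
  have term_left: "(\<lambda>\<omega>. u \<omega> * cnj (cnj (\<psi> n (S (- p n) \<omega>)) * h (S (- p n) \<omega>))) \<in> bounded_by (C * D)" for n
    using bounded_by_mult[OF u bounded_by_cnj[OF dual_term_bounded[OF \<psi> h]]] .
  have term_right: "(\<lambda>\<omega>. twist \<psi> p u n \<omega> * cnj (h \<omega>)) \<in> bounded_by (C * D)" for n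
    using bounded_by_mult[OF twist_bounded[OF \<psi> u] bounded_by_cnj[OF h]] .
  have transport: "(\<integral>\<omega>. u \<omega> * cnj (cnj (\<psi> n (S (- p n) \<omega>)) * h (S (- p n) \<omega>)) \<partial>M) = (\<integral>\<omega>. twist \<psi> p u n \<omega> * cnj (h \<omega>) \<partial>M)" for n
  proof -
    have "(\<integral>\<omega>. u \<omega> * cnj (cnj (\<psi> n (S (- p n) \<omega>)) * h (S (- p n) \<omega>)) \<partial>M)
       = (\<integral>\<omega>. u (S (p n) \<omega>) * cnj (cnj (\<psi> n (S (- p n) (S (p n) \<omega>))) * h (S (- p n) (S (p n) \<omega>))) \<partial>M)"
      using integral_S[OF bounded_by_measurable[OF term_left], of "p n" n] by simp
    also have "\<dots> = (\<integral>\<omega>. twist \<psi> p u n \<omega> * cnj (h \<omega>) \<partial>M)"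
    proof (rule Bochner_Integration.integral_cong[OF refl])
      fix \<omega> assume "\<omega> \<in> space M"
      then have "S (- p n) (S (p n) \<omega>) = \<omega>" using S_add[of \<omega> "- p n" "p n"] S_zero by simp
      then show "u (S (p n) \<omega>) * cnj (cnj (\<psi> n (S (- p n) (S (p n) \<omega>))) * h (S (- p n) (S (p n) \<omega>)))
          = twist \<psi> p u n \<omega> * cnj (h \<omega>)"
        by (simp add: twist_def mult_ac)
    qed
    finally show ?thesis .
  qed
  have "(\<integral>\<omega>. u \<omega> * cnj (dual N \<psi> p h \<omega>) \<partial>M)
      = (\<integral>\<omega>. (\<Sum>n=1..N. u \<omega> * cnj (cnj (\<psi> n (S (- p n) \<omega>)) * h (S (- p n) \<omega>))) / of_nat N \<partial>M)"
    by (simp add: dual_def avg_def sum_distrib_left)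
  also have "\<dots> = (\<Sum>n=1..N. \<integral>\<omega>. u \<omega> * cnj (cnj (\<psi> n (S (- p n) \<omega>)) * h (S (- p n) \<omega>)) \<partial>M) / of_nat N"
    by (subst integral_divide_zero, subst Bochner_Integration.integral_sum)
      (use integrable_bounded[OF term_left] in auto)
  also have "\<dots> = (\<Sum>n=1..N. \<integral>\<omega>. twist \<psi> p u n \<omega> * cnj (h \<omega>) \<partial>M) / of_nat N"
    by (simp only: transport)
  also have "\<dots> = (\<integral>\<omega>. (\<Sum>n=1..N. twist \<psi> p u n \<omega> * cnj (h \<omega>)) / of_nat N \<partial>M)"
    by (subst integral_divide_zero, subst Bochner_Integration.integral_sum)
      (use integrable_bounded[OF term_right] in auto)
  also have "\<dots> = (\<integral>\<omega>. avg N (twist \<psi> p u) \<omega> * cnj (h \<omega>) \<partial>M)"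
    by (simp add: avg_def sum_distrib_right)
  finally show ?thesis .
qed

text \<open>
  With \<open>\<sigma>\<close> the dual function, \<open>\<parallel>u - \<sigma>\<parallel>\<^sup>2 = \<parallel>u\<parallel>\<^sup>2 - 2 \<langle>u, \<sigma>\<rangle> + \<parallel>\<sigma>\<parallel>\<^sup>2\<close>, where \<open>\<langle>u, \<sigma>\<rangle> = \<parallel>h\<parallel>\<^sup>2\<close> by duality and
  \<open>\<parallel>\<sigma>\<parallel> \<le> \<parallel>h\<parallel>\<close>. The bound on \<open>\<sigma>\<close> is one in \<open>L\<^sup>2\<close>, so the gain does not deteriorate although the
  pointwise bounds double in every round.
\<close>
lemma energy_decrement:
  fixes p :: "nat \<Rightarrow> int" and N :: nat
  assumes \<psi>: "\<And>n. \<psi> n \<in> bounded_by 1" and u: "u \<in> bounded_by C"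
  defines "h \<equiv> avg N (twist \<psi> p u)"
  shows "(l2norm (u - dual N \<psi> p h))\<^sup>2 \<le> (l2norm u)\<^sup>2 - (l2norm h)\<^sup>2"
proof -
  define \<sigma> where "\<sigma> = dual N \<psi> p h"
  have h: "h \<in> bounded_by C" unfolding h_def by (intro avg_bounded twist_bounded \<psi> u)
  have \<sigma>: "\<sigma> \<in> bounded_by C" unfolding \<sigma>_def by (rule dual_bounded[OF \<psi> h])
  have "complex_of_real (\<integral>\<omega>. Re (u \<omega> * cnj (\<sigma> \<omega>)) \<partial>M) = complex_of_real (Re (\<integral>\<omega>. u \<omega> * cnj (\<sigma> \<omega>) \<partial>M))"
    by (simp only: integral_Re[OF integrable_bounded[OF bounded_by_mult[OF u bounded_by_cnj[OF \<sigma>]]]])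
  also have "(\<integral>\<omega>. u \<omega> * cnj (\<sigma> \<omega>) \<partial>M) = (\<integral>\<omega>. h \<omega> * cnj (h \<omega>) \<partial>M)"
    unfolding \<sigma>_def by (subst integral_twist_dual[OF \<psi> u h]) (simp add: h_def)
  also have "\<dots> = (\<integral>\<omega>. complex_of_real ((norm (h \<omega>))\<^sup>2) \<partial>M)"
    by (simp only: complex_norm_square)
  also have "\<dots> = complex_of_real ((l2norm h)\<^sup>2)"
    unfolding l2norm_sq by (simp only: integral_complex_of_real)
  finally have inner: "(\<integral>\<omega>. Re (u \<omega> * cnj (\<sigma> \<omega>)) \<partial>M) = (l2norm h)\<^sup>2"
    by (simp only: of_real_eq_iff Re_complex_of_real)
  have expand: "(norm (x - y))\<^sup>2 = (norm x)\<^sup>2 - 2 * Re (x * cnj y) + (norm y)\<^sup>2" for x y :: complex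
    unfolding cmod_power2 by (simp add: power2_eq_square algebra_simps)
  have "(l2norm (u - \<sigma>))\<^sup>2 = (\<integral>\<omega>. (norm (u \<omega>))\<^sup>2 - 2 * Re (u \<omega> * cnj (\<sigma> \<omega>)) + (norm (\<sigma> \<omega>))\<^sup>2 \<partial>M)"
    unfolding l2norm_sq by (simp only: minus_apply expand)
  also have "\<dots> = (l2norm u)\<^sup>2 - 2 * (l2norm h)\<^sup>2 + (l2norm \<sigma>)\<^sup>2"
  proof -
    have i: "integrable M (\<lambda>\<omega>. (norm (u \<omega>))\<^sup>2)" "integrable M (\<lambda>\<omega>. 2 * Re (u \<omega> * cnj (\<sigma> \<omega>)))"
      "integrable M (\<lambda>\<omega>. (norm (\<sigma> \<omega>))\<^sup>2)"
      by (rule integrable_norm_sq[OF u] integrable_norm_sq[OF \<sigma>] integrable_mult_right integrable_Re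
          integrable_bounded[OF bounded_by_mult[OF u bounded_by_cnj[OF \<sigma>]]])+
    show ?thesis
      unfolding Bochner_Integration.integral_add[OF Bochner_Integration.integrable_diff[OF i(1,2)] i(3)]
        Bochner_Integration.integral_diff[OF i(1,2)] integral_mult_right_zero inner l2norm_sq ..
  qed
  also have "\<dots> \<le> (l2norm u)\<^sup>2 - 2 * (l2norm h)\<^sup>2 + (l2norm h)\<^sup>2"
    using l2norm_dual[OF \<psi> h] l2norm_nonneg unfolding \<sigma>_def by (intro add_left_mono power_mono) auto
  finally show ?thesis unfolding \<sigma>_def by simp
qed

lemma sum_shift_le:
  fixes X :: "nat \<Rightarrow> complex"
  assumes "\<And>n. norm (X n) \<le> C"
  shows "norm ((\<Sum>n=1..N. X n) - (\<Sum>n=1..N. X (n + l))) \<le> 2 * real l * C"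
proof (induction l)
  case 0
  then show ?case by simp
next
  case (Suc l)
  have "(\<Sum>n=1..N. X (n + l)) + X (N + Suc l) = X (Suc l) + (\<Sum>n=1..N. X (n + Suc l))"
    by (induction N) (auto simp: add_ac)
  then have "(\<Sum>n=1..N. X (n + l)) - (\<Sum>n=1..N. X (n + Suc l)) = X (Suc l) - X (N + Suc l)"
    by (simp add: algebra_simps)
  then have "norm ((\<Sum>n=1..N. X (n + l)) - (\<Sum>n=1..N. X (n + Suc l))) \<le> C + C"
    using norm_triangle_ineq4[of "X (Suc l)" "X (N + Suc l)"] assms[of "Suc l"] assms[of "N + Suc l"] by simp
  then have "norm (((\<Sum>n=1..N. X n) - (\<Sum>n=1..N. X (n + l))) + ((\<Sum>n=1..N. X (n + l)) - (\<Sum>n=1..N. X (n + Suc l))))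
      \<le> 2 * real l * C + (C + C)"
    by (intro norm_triangle_le add_mono Suc.IH)
  then show ?case by (simp add: algebra_simps)
qed

text \<open>
  By the definition of \<open>\<sigma>\<close>, \<open>\<sigma> (S (p l) \<omega>)\<close> is the average of
  \<open>X n = cnj (\<psi> n (S (p l - p n) \<omega>)) \<cdot> h (S (p l - p n) \<omega>)\<close> over \<open>1 \<le> n \<le> N\<close>. Shifting the range
  of \<open>n\<close> by \<open>l\<close> costs at most \<open>2 l C / N\<close>, and for \<open>n = m + l\<close> with \<open>m\<close> fixed the exponent
  \<open>p l - p (l + m)\<close> has become the simpler sequence \<open>- \<Delta>\<^sub>m p\<close>. Averaging over \<open>l\<close> first thus gives a
  mixture over \<open>m\<close> of averages of lower complexity.
\<close>
lemma dual_approximation: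
  assumes Q: "\<And>m. complexity_le d (descendants p m Q)"
    and \<psi>: "\<psi> \<in> products q {r \<in> Q. \<not> degree_le 0 (r - p)}"
    and h: "h \<in> bounded_by C" and C: "0 < C" and N: "1 \<le> N"
  shows "\<exists>ws\<in>weighted_on (averages q d). mass ws = C \<and>
    (\<forall>N'. l2norm (avg N' (twist \<psi> p (dual N \<psi> p h)) - combine ws N') \<le> 2 * real N' * C / real N)"
proof -
  define R where "R = {r \<in> Q. \<not> degree_le 0 (r - p)}"
  define X where "X = (\<lambda>l \<omega> n. cnj (\<psi> n (S (p l - p n) \<omega>)) * h (S (p l - p n) \<omega>))"
  have \<psi>_bounded: "\<psi> n \<in> bounded_by 1" for n by (rule products_bounded[OF \<psi>])
  have "\<exists>\<Psi>\<in>products q (descendants p m Q). \<forall>l. \<forall>\<omega>\<in>space M. of_real C * \<Psi> l \<omega> = \<psi> l \<omega> * X l \<omega> (m + l)" for m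
  proof -
    have desc: "R \<subseteq> descendants p m Q" "insert (- shift_diff m p) ((\<lambda>r. r + shift_diff m (r - p)) ` R) \<subseteq> descendants p m Q"
      by (auto simp: descendants_def R_def Let_def)
    obtain \<psi>' where \<psi>': "\<psi>' \<in> products q (descendants p m Q)"
      "\<forall>l. \<forall>\<omega>\<in>space M. cnj (\<psi> (l + m) (S (p l - p (l + m)) \<omega>)) = \<psi>' l \<omega>"
      using products_shift[OF \<psi>, of m p] products_mono[OF _ desc(2)] unfolding R_def by blast
    \<comment> \<open>Members of \<open>products\<close> are bounded by \<open>1\<close>, so \<open>h\<close> is normalised here and the factor \<open>C\<close> reappears as the mass of the mixture.\<close>
    define h' where "h' = (\<lambda>\<omega>. of_real (1 / C) * h \<omega>)"
    have h': "h' \<in> bounded_by 1"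
      using bounded_by_mult[OF bounded_by_const[of "of_real (1 / C)" "1 / C"] h] C by (simp add: h'_def norm_divide)
    have mem: "- shift_diff m p \<in> insert 0 (descendants p m Q)" using desc(2) by blast
    define \<Psi> where "\<Psi> = (\<lambda>l \<omega>. \<psi> l \<omega> * \<psi>' l \<omega> * h' (S ((- shift_diff m p) l + 0) \<omega>))"
    have "\<Psi> \<in> products q (descendants p m Q)"
      unfolding \<Psi>_def using products.factor[OF products_mult[OF products_mono[OF \<psi>[folded R_def] desc(1)] \<psi>'(1)] mem h', of 0] .
    moreover have "of_real C * \<Psi> l \<omega> = \<psi> l \<omega> * X l \<omega> (m + l)" if "\<omega> \<in> space M" for l \<omega>
    proof -
      have "(- shift_diff m p) l + 0 = p l - p (l + m)" by (simp add: shift_diff_def)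
      then have "\<Psi> l \<omega> = \<psi> l \<omega> * cnj (\<psi> (l + m) (S (p l - p (l + m)) \<omega>)) * (of_real (1 / C) * h (S (p l - p (l + m)) \<omega>))"
        using \<psi>'(2) that unfolding \<Psi>_def h'_def by (simp only:) 
      then show ?thesis using C by (simp add: X_def add.commute)
    qed
    ultimately show ?thesis by blast
  qed
  then obtain \<Psi> where \<Psi>: "\<And>m. \<Psi> m \<in> products q (descendants p m Q)"
    "\<And>m l \<omega>. \<omega> \<in> space M \<Longrightarrow> of_real C * \<Psi> m l \<omega> = \<psi> l \<omega> * X l \<omega> (m + l)"
    by metis
  define ws where "ws = map (\<lambda>m. (C / real N, \<lambda>N'. avg N' (\<Psi> m))) [1..<Suc N]"
  have "(\<lambda>N'. avg N' (\<Psi> m)) \<in> averages q d" for m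
    unfolding averages_def using \<Psi>(1) Q by blast
  then have ws: "ws \<in> weighted_on (averages q d)"
    using C by (auto simp: ws_def weighted_on_def)
  have "mass ws = C"
    using N by (simp add: ws_def mass_def comp_def sum_list_triv del: upt_Suc)
  moreover have combine: "combine ws N' \<omega> = (\<Sum>m=1..N. of_real (C / real N) * avg N' (\<Psi> m) \<omega>)" for N' \<omega>
    unfolding combine_def ws_def map_map comp_def prod.case
    by (subst interv_sum_list_conv_sum_set_nat) (simp add: atLeastLessThanSuc_atLeastAtMost del: upt_Suc)
  moreover have "l2norm (avg N' (twist \<psi> p (dual N \<psi> p h)) - combine ws N') \<le> 2 * real N' * C / real N" for N'
  proof (rule l2norm_le)
    let ?f = "avg N' (twist \<psi> p (dual N \<psi> p h)) - combine ws N'"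
    have "avg N' (twist \<psi> p (dual N \<psi> p h)) \<in> bounded_by C"
      by (intro avg_bounded twist_bounded \<psi>_bounded dual_bounded h)
    moreover have "combine ws N' \<in> bounded_by (mass ws)"
      by (rule combine_bounded[OF ws averages_bounded])
    ultimately have meas: "?f \<in> borel_measurable M"
      using bounded_by_diff bounded_by_measurable by blast
    have "norm (?f \<omega>) \<le> 2 * real N' * C / real N" if \<omega>: "\<omega> \<in> space M" for \<omega>
    proof -
      have X: "norm (X l \<omega> n) \<le> C" for l n
        using bounded_byD[OF \<psi>_bounded S_space[OF \<omega>], of n "p l - p n"] bounded_byD[OF h S_space[OF \<omega>], of "p l - p n"]
          mult_mono[of "norm (\<psi> n (S (p l - p n) \<omega>))" 1 "norm (h (S (p l - p n) \<omega>))" C]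
        by (simp add: X_def norm_mult)
      have dual: "dual N \<psi> p h (S (p l) \<omega>) = (\<Sum>n=1..N. X l \<omega> n) / of_nat N" for l
        using S_add[OF \<omega>, of "- p _" "p l"] by (simp add: dual_def avg_def X_def)
      have term_bound: "norm (\<psi> l \<omega> * (((\<Sum>n=1..N. X l \<omega> n) - (\<Sum>n=1..N. X l \<omega> (n + l))) / of_nat N))
          \<le> 2 * real N' * C / real N" if l: "l \<in> {1..N'}" for l
      proof -
        have "norm ((\<Sum>n=1..N. X l \<omega> n) - (\<Sum>n=1..N. X l \<omega> (n + l))) \<le> 2 * real l * C"
          by (rule sum_shift_le[OF X])
        also have "\<dots> \<le> 2 * real N' * C" using l C by (intro mult_right_mono) auto
        finally have "norm (((\<Sum>n=1..N. X l \<omega> n) - (\<Sum>n=1..N. X l \<omega> (n + l))) / of_nat N) \<le> 2 * real N' * C / real N"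
          by (simp add: norm_divide divide_right_mono)
        then have "norm (\<psi> l \<omega>) * norm (((\<Sum>n=1..N. X l \<omega> n) - (\<Sum>n=1..N. X l \<omega> (n + l))) / of_nat N)
            \<le> 1 * (2 * real N' * C / real N)"
          using bounded_byD[OF \<psi>_bounded \<omega>, of l] by (intro mult_mono) auto
        then show ?thesis by (simp only: norm_mult mult_1)
      qed
      have "avg N' (twist \<psi> p (dual N \<psi> p h)) \<omega>
          = (\<Sum>l=1..N'. \<psi> l \<omega> * ((\<Sum>n=1..N. X l \<omega> n) / of_nat N)) / of_nat N'"
        by (simp add: avg_def twist_def dual)
      moreover have "combine ws N' \<omega> = (\<Sum>l=1..N'. \<psi> l \<omega> * ((\<Sum>n=1..N. X l \<omega> (n + l)) / of_nat N)) / of_nat N'"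
      proof -
        have "combine ws N' \<omega> = (\<Sum>m=1..N. \<Sum>l=1..N'. of_real C * \<Psi> m l \<omega> / of_nat N / of_nat N')"
          unfolding combine avg_def by (simp add: sum_distrib_left sum_divide_distrib field_simps)
        also have "\<dots> = (\<Sum>l=1..N'. \<Sum>m=1..N. \<psi> l \<omega> * X l \<omega> (m + l) / of_nat N / of_nat N')"
          unfolding \<Psi>(2)[OF \<omega>] by (rule sum.swap)
        finally show ?thesis by (simp add: sum_distrib_left sum_divide_distrib)
      qed
      ultimately have "?f \<omega>
          = (\<Sum>l=1..N'. \<psi> l \<omega> * (((\<Sum>n=1..N. X l \<omega> n) - (\<Sum>n=1..N. X l \<omega> (n + l))) / of_nat N)) / of_nat N'"
        by (simp only: minus_apply diff_divide_distrib right_diff_distrib sum_subtractf)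
      then have "norm (?f \<omega>) = norm (\<Sum>l=1..N'. \<psi> l \<omega> * (((\<Sum>n=1..N. X l \<omega> n) - (\<Sum>n=1..N. X l \<omega> (n + l))) / of_nat N)) / real N'"
        by (simp only: norm_divide norm_of_nat)
      also have "\<dots> \<le> (\<Sum>l=1..N'. 2 * real N' * C / real N) / real N'"
        by (intro divide_right_mono sum_norm_le term_bound) auto
      also have "\<dots> \<le> 2 * real N' * C / real N" using C by (cases "N' = 0") auto
      finally show ?thesis .
    qed
    with meas show "?f \<in> bounded_by (2 * real N' * C / real N)" unfolding bounded_by_def by blast
  qed
  ultimately show ?thesis using ws by blast
qed

lemma twist_diff: "avg N (twist \<psi> p (u - v)) = avg N (twist \<psi> p u) - avg N (twist \<psi> p v)"
  by (simp add: avg_def twist_def fun_eq_iff right_diff_distrib sum_subtractf diff_divide_distrib)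

lemma steady_if_twist_small:
  assumes small: "\<And>N. N \<in> {s..t} \<Longrightarrow> l2norm (avg N (twist \<psi> p u)) \<le> \<epsilon>"
    and a: "steady \<epsilon> s t a" "\<And>N. a N \<in> bounded_by D"
    and \<psi>: "\<And>n. \<psi> n \<in> bounded_by 1" and u: "u \<in> bounded_by C" and b: "\<And>N. b N \<in> bounded_by 1"
    and close: "\<And>N. N \<in> {s..t} \<Longrightarrow> l2norm (b N - (avg N (twist \<psi> p u) + a N)) \<le> e"
  shows "steady (3 * \<epsilon> + 2 * e) s t b"
  unfolding steady_def
proof (intro ballI)
  fix N N' assume N: "N \<in> {s..t}" "N' \<in> {s..t}"
  define x where "x = (\<lambda>N. avg N (twist \<psi> p u))"
  have x: "x N \<in> bounded_by C" for N unfolding x_def by (intro avg_bounded twist_bounded \<psi> u)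
  have xa: "x N + a N \<in> bounded_by (C + D)" for N by (intro bounded_by_add x a)
  have "l2norm (b N - b N') \<le> l2norm (b N - (x N + a N)) + l2norm ((x N + a N) - b N')"
    by (rule l2norm_dist_triangle[OF b xa b])
  moreover have "l2norm ((x N + a N) - b N') \<le> l2norm ((x N + a N) - (x N' + a N')) + l2norm ((x N' + a N') - b N')"
    by (rule l2norm_dist_triangle[OF xa xa b])
  moreover have "l2norm ((x N + a N) - (x N' + a N')) \<le> l2norm (x N - x N') + l2norm (a N - a N')"
    using l2norm_triangle[OF bounded_by_diff[OF x x] bounded_by_diff[OF a(2) a(2)], of N N' N N']
    by (simp only: add_diff_add)
  moreover have "l2norm (x N - x N') \<le> l2norm (x N) + l2norm (x N')"
    by (rule l2norm_triangle_diff[OF x x])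
  moreover have "l2norm (a N - a N') \<le> \<epsilon>" using a(1) N by (auto simp: steady_def)
  moreover have "l2norm ((x N' + a N') - b N') = l2norm (b N' - (x N' + a N'))" by (rule l2norm_diff_commute)
  ultimately show "l2norm (b N - b N') \<le> 3 * \<epsilon> + 2 * e"
    using small[OF N(1)] small[OF N(2)] close[OF N(1)] close[OF N(2)] unfolding x_def by linarith
qed

text \<open>
  State of the energy argument: up to the horizon \<open>B\<close> and up to the error \<open>e\<close>, the sequence \<open>b\<close> is the
  sum of the averages of a remainder \<open>u\<close> of energy at most \<open>E\<close> and of a mixture of simpler averages.
  The constant \<open>C\<close> bounds both the remainder and the mass of the mixture.
\<close>
definition decomposed :: "nat \<Rightarrow> nat \<Rightarrow> real \<Rightarrow> real \<Rightarrow> real \<Rightarrow> nat \<Rightarrow> (nat \<Rightarrow> 'a \<Rightarrow> complex) \<Rightarrow> bool" where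
  "decomposed q d C E e B b \<longleftrightarrow> (\<forall>N. b N \<in> bounded_by 1) \<and>
     (\<exists>Q p \<psi> u. \<exists>a\<in>mixtures C (averages q d).
       (\<forall>m. complexity_le d (descendants p m Q)) \<and> \<psi> \<in> products q {r \<in> Q. \<not> degree_le 0 (r - p)} \<and>
       u \<in> bounded_by C \<and> (l2norm u)\<^sup>2 \<le> E \<and>
       (\<forall>N\<le>B. l2norm (b N - (avg N (twist \<psi> p u) + a N)) \<le> e))"

text \<open>
  Choose a scale \<open>t\<close> at which the structured part is steady. Either the remainder has small averages
  on all of \<open>[t, F t]\<close>, and then \<open>b\<close> is steady as well, or some \<open>N\<close> in this interval yields a dual
  function to be moved into the structured part. As \<open>N \<ge> L\<close>, its approximation by simpler averages is
  valid up to a horizon \<open>B'\<close> that is small compared with \<open>L\<close>.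
\<close>
lemma steady_or_decompose:
  assumes b: "decomposed q d C E e B b" and C: "0 < C" and \<epsilon>: "0 \<le> \<epsilon>"
    and mix: "\<And>a. a \<in> mixtures C (averages q d) \<Longrightarrow> \<exists>t\<in>T. steady \<epsilon> t (F t) a"
    and T: "\<And>t. t \<in> T \<Longrightarrow> F t \<le> B \<and> L \<le> t" "1 \<le> L" "2 * real B' * C \<le> \<eta> * real L" "B' \<le> B"
  shows "(\<exists>t\<in>T. steady (3 * \<epsilon> + 2 * e) t (F t) b) \<or> (\<epsilon>\<^sup>2 \<le> E \<and> decomposed q d (2 * C) (E - \<epsilon>\<^sup>2) (e + \<eta>) B' b)"
proof -
  obtain Q p \<psi> u a where D: "\<And>N. b N \<in> bounded_by 1" "a \<in> mixtures C (averages q d)"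
    "\<And>m. complexity_le d (descendants p m Q)" "\<psi> \<in> products q {r \<in> Q. \<not> degree_le 0 (r - p)}"
    "u \<in> bounded_by C" "(l2norm u)\<^sup>2 \<le> E" "\<And>N. N \<le> B \<Longrightarrow> l2norm (b N - (avg N (twist \<psi> p u) + a N)) \<le> e"
    using b unfolding decomposed_def by blast
  obtain vs where vs: "a = combine vs" "vs \<in> weighted_on (averages q d)" "mass vs \<le> C"
    using D(2) by (auto simp: mixtures_def)
  have \<psi>: "\<psi> n \<in> bounded_by 1" for n by (rule products_bounded[OF D(4)])
  have a: "a N \<in> bounded_by (mass vs)" for N unfolding vs(1) by (rule combine_bounded[OF vs(2) averages_bounded])
  obtain t where t: "t \<in> T" "steady \<epsilon> t (F t) a" using mix[OF D(2)] by blast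
  show ?thesis
  proof (cases "\<forall>N\<in>{t..F t}. l2norm (avg N (twist \<psi> p u)) \<le> \<epsilon>")
    case True
    have "steady (3 * \<epsilon> + 2 * e) t (F t) b"
    proof (rule steady_if_twist_small[OF _ t(2) a \<psi> D(5,1)])
      show "l2norm (avg N (twist \<psi> p u)) \<le> \<epsilon>" if "N \<in> {t..F t}" for N using True that by blast
      show "l2norm (b N - (avg N (twist \<psi> p u) + a N)) \<le> e" if "N \<in> {t..F t}" for N
        using that T(1)[OF t(1)] by (intro D(7)) auto
    qed
    then show ?thesis using t(1) by blast
  next
    case False
    then obtain N where N: "t \<le> N" "\<epsilon> < l2norm (avg N (twist \<psi> p u))" by force
    define h where "h = avg N (twist \<psi> p u)"
    define \<sigma> where "\<sigma> = dual N \<psi> p h"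
    have h: "h \<in> bounded_by C" unfolding h_def by (intro avg_bounded twist_bounded \<psi> D)
    have \<sigma>: "\<sigma> \<in> bounded_by C" unfolding \<sigma>_def by (rule dual_bounded[OF \<psi> h])
    have N1: "1 \<le> N" "real L \<le> real N" using N(1) T(1)[OF t(1)] T(2) by auto
    have h_large: "\<epsilon>\<^sup>2 \<le> (l2norm h)\<^sup>2" using N(2) \<epsilon> unfolding h_def by (intro power_mono) auto
    have energy: "(l2norm (u - \<sigma>))\<^sup>2 \<le> E - \<epsilon>\<^sup>2"
      using energy_decrement[where \<psi> = \<psi> and N = N and p = p, OF \<psi> D(5)] h_large D(6) unfolding \<sigma>_def h_def by linarith
    obtain ws where ws: "ws \<in> weighted_on (averages q d)" "mass ws = C"
      "\<And>N'. l2norm (avg N' (twist \<psi> p \<sigma>) - combine ws N') \<le> 2 * real N' * C / real N"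
      using dual_approximation[OF D(3,4) h C N1(1)] unfolding \<sigma>_def by blast
    have "combine (vs @ ws) \<in> mixtures (2 * C) (averages q d)"
      using vs ws by (auto simp: mixtures_def)
    moreover have "u - \<sigma> \<in> bounded_by (2 * C)" using bounded_by_diff[OF D(5) \<sigma>] by simp
    moreover have "l2norm (b N' - (avg N' (twist \<psi> p (u - \<sigma>)) + combine (vs @ ws) N')) \<le> e + \<eta>" if N': "N' \<le> B'" for N'
    proof -
      have x: "avg N' (twist \<psi> p v) \<in> bounded_by C" if "v \<in> bounded_by C" for v
        using that by (intro avg_bounded twist_bounded \<psi>)
      have "b N' - (avg N' (twist \<psi> p (u - \<sigma>)) + combine (vs @ ws) N')
          = (b N' - (avg N' (twist \<psi> p u) + a N')) + (avg N' (twist \<psi> p \<sigma>) - combine ws N')"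
        unfolding twist_diff combine_simps vs(1) by (simp add: algebra_simps)
      then have "l2norm (b N' - (avg N' (twist \<psi> p (u - \<sigma>)) + combine (vs @ ws) N'))
          \<le> l2norm (b N' - (avg N' (twist \<psi> p u) + a N')) + l2norm (avg N' (twist \<psi> p \<sigma>) - combine ws N')"
        by (simp only:) (rule l2norm_triangle[OF bounded_by_diff[OF D(1) bounded_by_add[OF x[OF D(5)] a]]
            bounded_by_diff[OF x[OF \<sigma>] combine_bounded[OF ws(1) averages_bounded]]])
      moreover have "l2norm (avg N' (twist \<psi> p \<sigma>) - combine ws N') \<le> \<eta>"
      proof -
        have "2 * real N' * C \<le> 2 * real B' * C" using N' C by (intro mult_right_mono mult_left_mono) auto
        also have "\<dots> \<le> \<eta> * real L" by (rule T(3))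
        also have "\<dots> \<le> \<eta> * real N"
        proof (rule mult_left_mono[OF N1(2)])
          have "0 \<le> 2 * real B' * C" using C by simp
          then have "0 \<le> \<eta> * real L" using T(3) by linarith
          then show "0 \<le> \<eta>" using T(2) by (simp add: zero_le_mult_iff)
        qed
        finally have "2 * real N' * C / real N \<le> \<eta>" using N1(1) by (simp add: divide_le_eq)
        then show ?thesis using ws(3)[of N'] by linarith
      qed
      moreover have "l2norm (b N' - (avg N' (twist \<psi> p u) + a N')) \<le> e" using N' T(4) by (intro D(7)) auto
      ultimately show ?thesis by linarith
    qed
    ultimately have "decomposed q d (2 * C) (E - \<epsilon>\<^sup>2) (e + \<eta>) B' b"
      unfolding decomposed_def using D(1,3,4) energy by blast
    moreover have "\<epsilon>\<^sup>2 \<le> E"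
      using energy zero_le_power2[of "l2norm (u - \<sigma>)"] by linarith
    ultimately show ?thesis by blast
  qed
qed

lemma metastable_mixtures_averages:
  "metastable (averages q d) \<Longrightarrow> metastable (mixtures C (averages q d))"
  by (rule metastable_mixtures) (auto intro: averages_bounded)

text \<open>
  Induction on the number \<open>r\<close> of quanta \<open>\<epsilon>\<^sup>2\<close> of energy. The scales \<open>T'\<close> and the horizon \<open>B'\<close> of the
  remaining rounds are fixed first; the scales \<open>T\<close> of the present round are then taken beyond
  \<open>2 B' C / \<eta>\<close>, so that a dual function found in this round is usable in all later rounds.
\<close>
lemma metastable_decomposed:
  assumes meta: "metastable (averages q d)" and \<epsilon>: "0 < \<epsilon>" and \<eta>: "0 < \<eta>" and C: "0 < C"
  shows "\<exists>K. \<forall>F L. \<exists>T B. finite T \<and> card T \<le> K \<and> (\<forall>t\<in>T. L \<le> t) \<and>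
    (\<forall>b. decomposed q d C (real r * \<epsilon>\<^sup>2) e B b \<longrightarrow> (\<exists>t\<in>T. steady (3 * \<epsilon> + 2 * e + 2 * real r * \<eta>) t (F t) b))"
  using C
proof (induction r arbitrary: C e)
  case 0
  obtain K where K: "\<forall>F L. \<exists>T. finite T \<and> card T \<le> K \<and> (\<forall>t\<in>T. L \<le> t) \<and>
      (\<forall>a\<in>mixtures C (averages q d). \<exists>t\<in>T. steady \<epsilon> t (F t) a)"
    using metastable_mixtures_averages[OF meta, unfolded metastable_def, rule_format, OF \<epsilon>] ..
  show ?case
  proof (intro exI[of _ K] allI)
    fix F L
    obtain T where T: "finite T" "card T \<le> K" "\<forall>t\<in>T. max L 1 \<le> t"
      "\<forall>a\<in>mixtures C (averages q d). \<exists>t\<in>T. steady \<epsilon> t (F t) a"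
      using spec[OF spec[OF K, of F], of "max L 1"] by blast
    define B where "B = Max (insert 0 (F ` T))"
    have B: "F t \<le> B" if "t \<in> T" for t using T(1) that by (simp add: B_def)
    have "\<exists>t\<in>T. steady (3 * \<epsilon> + 2 * e + 2 * real 0 * \<eta>) t (F t) b" if b: "decomposed q d C (real 0 * \<epsilon>\<^sup>2) e B b" for b
    proof -
      have "\<not> \<epsilon>\<^sup>2 \<le> real 0 * \<epsilon>\<^sup>2" using \<epsilon> by simp
      then have "\<exists>t\<in>T. steady (3 * \<epsilon> + 2 * e) t (F t) b"
        using steady_or_decompose[OF b 0 less_imp_le[OF \<epsilon>], of T F "max L 1" 0 \<eta>] T(3,4) B \<eta> by auto
      then show ?thesis by simp
    qed
    then show "\<exists>T B. finite T \<and> card T \<le> K \<and> (\<forall>t\<in>T. L \<le> t) \<and>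
      (\<forall>b. decomposed q d C (real 0 * \<epsilon>\<^sup>2) e B b \<longrightarrow> (\<exists>t\<in>T. steady (3 * \<epsilon> + 2 * e + 2 * real 0 * \<eta>) t (F t) b))"
      using T(1-3) by (intro exI[of _ T] exI[of _ B]) auto
  qed
next
  case (Suc r)
  obtain K where K: "\<forall>F L. \<exists>T. finite T \<and> card T \<le> K \<and> (\<forall>t\<in>T. L \<le> t) \<and>
      (\<forall>a\<in>mixtures C (averages q d). \<exists>t\<in>T. steady \<epsilon> t (F t) a)"
    using metastable_mixtures_averages[OF meta, unfolded metastable_def, rule_format, OF \<epsilon>] ..
  have "0 < 2 * C" using Suc.prems by simp
  from Suc.IH[OF this, of "e + \<eta>"] obtain K' where K': "\<forall>F L. \<exists>T B. finite T \<and> card T \<le> K' \<and> (\<forall>t\<in>T. L \<le> t) \<and>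
    (\<forall>b. decomposed q d (2 * C) (real r * \<epsilon>\<^sup>2) (e + \<eta>) B b \<longrightarrow>
      (\<exists>t\<in>T. steady (3 * \<epsilon> + 2 * (e + \<eta>) + 2 * real r * \<eta>) t (F t) b))" ..
  show ?case
  proof (intro exI[of _ "K + K'"] allI)
    fix F L
    obtain T' B' where T': "finite T'" "card T' \<le> K'" "\<forall>t\<in>T'. L \<le> t"
      "\<forall>b. decomposed q d (2 * C) (real r * \<epsilon>\<^sup>2) (e + \<eta>) B' b \<longrightarrow>
        (\<exists>t\<in>T'. steady (3 * \<epsilon> + 2 * (e + \<eta>) + 2 * real r * \<eta>) t (F t) b)"
      using spec[OF spec[OF K', of F], of L] by (elim exE conjE)
    define L' where "L' = max L (max 1 (nat \<lceil>2 * real B' * C / \<eta>\<rceil>))"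
    have "2 * real B' * C / \<eta> \<le> real L'" unfolding L'_def by linarith
    then have L': "L \<le> L'" "1 \<le> L'" "2 * real B' * C \<le> \<eta> * real L'"
      using \<eta> by (auto simp: L'_def field_simps)
    obtain T where T: "finite T" "card T \<le> K" "\<forall>t\<in>T. L' \<le> t"
      "\<forall>a\<in>mixtures C (averages q d). \<exists>t\<in>T. steady \<epsilon> t (F t) a"
      using spec[OF spec[OF K, of F], of L'] by blast
    define B where "B = Max (insert B' (F ` T))"
    have B: "F t \<le> B" if "t \<in> T" for t using T(1) that by (simp add: B_def)
    have B': "B' \<le> B" using T(1) by (simp add: B_def)
    have "\<exists>t\<in>T \<union> T'. steady (3 * \<epsilon> + 2 * e + 2 * real (Suc r) * \<eta>) t (F t) b"
      if b: "decomposed q d C (real (Suc r) * \<epsilon>\<^sup>2) e B b" for b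
    proof -
      consider t where "t \<in> T" "steady (3 * \<epsilon> + 2 * e) t (F t) b"
        | "decomposed q d (2 * C) (real (Suc r) * \<epsilon>\<^sup>2 - \<epsilon>\<^sup>2) (e + \<eta>) B' b"
        using steady_or_decompose[OF b Suc.prems less_imp_le[OF \<epsilon>], of T F L' B' \<eta>] T(3,4) B B' L' by blast
      then show ?thesis
      proof cases
        case 1
        moreover have "0 \<le> 2 * real (Suc r) * \<eta>" using \<eta> by simp
        ultimately have "steady (3 * \<epsilon> + 2 * e + 2 * real (Suc r) * \<eta>) t (F t) b"
          unfolding steady_def by (meson add_increasing2 order_trans order_refl)
        then show ?thesis using 1 by blast
      next
        case 2
        then obtain t where t: "t \<in> T'" "steady (3 * \<epsilon> + 2 * (e + \<eta>) + 2 * real r * \<eta>) t (F t) b"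
          using T'(4) by (auto simp: algebra_simps)
        have "3 * \<epsilon> + 2 * (e + \<eta>) + 2 * real r * \<eta> = 3 * \<epsilon> + 2 * e + 2 * real (Suc r) * \<eta>"
          by (simp add: algebra_simps)
        with t(2) have "steady (3 * \<epsilon> + 2 * e + 2 * real (Suc r) * \<eta>) t (F t) b" by (simp only:)
        then show ?thesis using t(1) by blast
      qed
    qed
    moreover have "card (T \<union> T') \<le> K + K'" using card_Un_le[of T T'] T(2) T'(2) by linarith
    moreover have "\<forall>t\<in>T \<union> T'. L \<le> t" using T(3) T'(3) L'(1) by auto
    ultimately show "\<exists>T B. finite T \<and> card T \<le> K + K' \<and> (\<forall>t\<in>T. L \<le> t) \<and>
      (\<forall>b. decomposed q d C (real (Suc r) * \<epsilon>\<^sup>2) e B b \<longrightarrow> (\<exists>t\<in>T. steady (3 * \<epsilon> + 2 * e + 2 * real (Suc r) * \<eta>) t (F t) b))"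
      using T(1) T'(1) by (intro exI[of _ "T \<union> T'"] exI[of _ B]) auto
  qed
qed

lemma metastable_complexity_Suc:
  assumes "metastable (averages q d)"
  shows "metastable (averages q (Suc d))"
  unfolding metastable_def
proof (intro allI impI)
  fix \<delta> :: real assume \<delta>: "0 < \<delta>"
  define \<epsilon> where "\<epsilon> = \<delta> / 6"
  define r where "r = nat \<lceil>1 / \<epsilon>\<^sup>2\<rceil>"
  define \<eta> where "\<eta> = \<delta> / (4 * real (Suc r))"
  \<comment> \<open>The initial energy is at most \<open>1 \<le> r \<epsilon>\<^sup>2\<close>; half of \<open>\<delta>\<close> pays for \<open>3 \<epsilon>\<close> and half for the errors \<open>\<eta>\<close> of the \<open>r\<close> rounds.\<close>
  have pos: "0 < \<epsilon>" "0 < \<eta>" using \<delta> by (auto simp: \<epsilon>_def \<eta>_def)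
  have "1 / \<epsilon>\<^sup>2 \<le> real r" unfolding r_def by linarith
  then have r: "1 \<le> real r * \<epsilon>\<^sup>2" using pos by (simp add: field_simps)
  have "2 * real r * \<eta> \<le> \<delta> / 2" using \<delta> by (simp add: \<eta>_def field_simps)
  then have error: "3 * \<epsilon> + 2 * 0 + 2 * real r * \<eta> \<le> \<delta>" by (simp add: \<epsilon>_def)
  have decomposed: "decomposed q d 1 (real r * \<epsilon>\<^sup>2) 0 B a" if a: "a \<in> averages q (Suc d)" for a B
  proof -
    obtain \<phi> Q where \<phi>: "a = (\<lambda>N. avg N \<phi>)" "\<phi> \<in> products q Q" "complexity_le (Suc d) Q"
      using a unfolding averages_def by blast
    obtain p where p: "\<And>m. complexity_le d (descendants p m Q)"
      using \<phi>(3) by (auto simp: complexity_le_def)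
    obtain \<psi> g where \<psi>: "\<psi> \<in> products q {r \<in> Q. \<not> degree_le 0 (r - p)}" "g \<in> bounded_by 1"
      "\<And>n \<omega>. \<omega> \<in> space M \<Longrightarrow> \<phi> n \<omega> = \<psi> n \<omega> * g (S (p n) \<omega>)"
      using products_split[OF \<phi>(2), of p] by blast
    have "(l2norm g)\<^sup>2 \<le> 1\<^sup>2" by (intro power_mono l2norm_le[OF \<psi>(2)] l2norm_nonneg)
    moreover have "combine [] \<in> mixtures 1 (averages q d)" by (auto simp: mixtures_def)
    moreover have "l2norm (a N - (avg N (twist \<psi> p g) + combine [] N)) \<le> 0" for N
    proof -
      have "l2norm (a N - (avg N (twist \<psi> p g) + combine [] N)) = l2norm (\<lambda>_. 0)"
        using \<psi>(3) by (intro l2norm_cong) (simp add: \<phi>(1) avg_def twist_def combine_simps)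
      then show ?thesis by simp
    qed
    ultimately show ?thesis
      unfolding decomposed_def using averages_bounded[OF a] p \<psi>(1,2) r
      by (intro conjI allI exI[of _ Q] exI[of _ p] exI[of _ \<psi>] exI[of _ g] bexI[of _ "combine []"]) auto
  qed
  obtain K where K: "\<forall>F L. \<exists>T B. finite T \<and> card T \<le> K \<and> (\<forall>t\<in>T. L \<le> t) \<and>
    (\<forall>b. decomposed q d 1 (real r * \<epsilon>\<^sup>2) 0 B b \<longrightarrow> (\<exists>t\<in>T. steady (3 * \<epsilon> + 2 * 0 + 2 * real r * \<eta>) t (F t) b))"
    using metastable_decomposed[OF assms pos zero_less_one, of r 0] ..
  show "\<exists>K. \<forall>F L. \<exists>T. finite T \<and> card T \<le> K \<and> (\<forall>t\<in>T. L \<le> t) \<and>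
     (\<forall>a\<in>averages q (Suc d). \<exists>t\<in>T. steady \<delta> t (F t) a)"
  proof (intro exI[of _ K] allI)
    fix F L
    obtain T B where T: "finite T" "card T \<le> K" "\<forall>t\<in>T. L \<le> t"
      "\<forall>b. decomposed q d 1 (real r * \<epsilon>\<^sup>2) 0 B b \<longrightarrow> (\<exists>t\<in>T. steady (3 * \<epsilon> + 2 * 0 + 2 * real r * \<eta>) t (F t) b)"
      using spec[OF spec[OF K, of F], of L] by (elim exE conjE)
    have "\<exists>t\<in>T. steady \<delta> t (F t) a" if a: "a \<in> averages q (Suc d)" for a
    proof -
      obtain t where "t \<in> T" "steady (3 * \<epsilon> + 2 * 0 + 2 * real r * \<eta>) t (F t) a"
        using T(4) decomposed[OF a] by blast
      then show ?thesis using error unfolding steady_def by (meson order_trans)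
    qed
    then show "\<exists>T. finite T \<and> card T \<le> K \<and> (\<forall>t\<in>T. L \<le> t) \<and> (\<forall>a\<in>averages q (Suc d). \<exists>t\<in>T. steady \<delta> t (F t) a)"
      using T(1-3) by blast
  qed
qed

theorem metastable_averages: "1 \<le> q \<Longrightarrow> metastable (averages q d)"
  by (induction d) (auto intro: metastable_complexity_zero metastable_complexity_Suc)

end

section \<open>Limits of bounded Cauchy sequences\<close>

context prob_space
begin

lemma integral_norm_le:
  assumes "f \<in> bounded_by C" "l2norm f \<le> \<delta>" "0 < \<delta>"
  shows "(\<integral>\<omega>. norm (f \<omega>) \<partial>M) \<le> \<delta>"
proof -
  have "norm (f \<omega>) \<le> \<delta> / 2 + (norm (f \<omega>))\<^sup>2 / (2 * \<delta>)" for \<omega>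
  proof -
    have "0 \<le> (norm (f \<omega>) - \<delta>)\<^sup>2" by simp
    then show ?thesis using assms(3) by (simp add: field_simps power2_eq_square)
  qed
  then have "(\<integral>\<omega>. norm (f \<omega>) \<partial>M) \<le> (\<integral>\<omega>. \<delta> / 2 + (norm (f \<omega>))\<^sup>2 / (2 * \<delta>) \<partial>M)"
    using integrable_bounded[OF assms(1)] integrable_norm_sq[OF assms(1)]
    by (intro integral_mono Bochner_Integration.integrable_add integrable_norm integrable_divide) auto
  also have "\<dots> = \<delta> / 2 + (l2norm f)\<^sup>2 / (2 * \<delta>)"
    using integrable_norm_sq[OF assms(1)]
    by (subst Bochner_Integration.integral_add) (auto simp: l2norm_sq prob_space)
  also have "\<dots> \<le> \<delta> / 2 + \<delta>\<^sup>2 / (2 * \<delta>)"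
    using assms l2norm_nonneg[of f] by (intro add_left_mono divide_right_mono power_mono) auto
  also have "\<dots> = \<delta>" using assms(3) by (simp add: power2_eq_square)
  finally show ?thesis .
qed

text \<open>
  Increments that are summable in \<open>L\<^sup>2\<close> are summable in \<open>L\<^sup>1\<close>, hence summable at almost every point. The
  pointwise limit inherits the bound \<open>C\<close>, and dominated convergence upgrades the convergence to \<open>L\<^sup>2\<close>.
\<close>
lemma fast_Cauchy_limit:
  assumes a: "\<And>k. a k \<in> bounded_by C" and fast: "\<And>k. l2norm (a (Suc k) - a k) \<le> (1 / 2) ^ k"
  shows "\<exists>g\<in>bounded_by C. (\<lambda>k. l2norm (a k - g)) \<longlonglongrightarrow> 0"
proof -
  have [measurable]: "a k \<in> borel_measurable M" for k using bounded_by_measurable[OF a] .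
  have d: "a (Suc k) - a k \<in> bounded_by (C + C)" for k by (intro bounded_by_diff a)
  have "(\<integral>\<^sup>+\<omega>. ennreal (norm (a (Suc k) \<omega> - a k \<omega>)) \<partial>M) \<le> ennreal ((1 / 2) ^ k)" for k
  proof -
    have "(\<integral>\<^sup>+\<omega>. ennreal (norm ((a (Suc k) - a k) \<omega>)) \<partial>M) = ennreal (\<integral>\<omega>. norm ((a (Suc k) - a k) \<omega>) \<partial>M)"
      using integrable_norm[OF integrable_bounded[OF d]] by (intro nn_integral_eq_integral) auto
    also have "\<dots> \<le> ennreal ((1 / 2) ^ k)"
      using integral_norm_le[OF d fast] by (intro ennreal_leI) auto
    finally show ?thesis by simp
  qed
  then have "(\<integral>\<^sup>+\<omega>. (\<Sum>k. ennreal (norm (a (Suc k) \<omega> - a k \<omega>))) \<partial>M) \<le> (\<Sum>k. ennreal ((1 / 2) ^ k))"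
    by (subst nn_integral_suminf) (auto intro!: suminf_le)
  moreover have "(\<Sum>k. ennreal ((1 / 2) ^ k)) \<noteq> top"
    by (rule ennreal_suminf_neq_top) (simp_all add: summable_geometric)
  ultimately have "(\<integral>\<^sup>+\<omega>. (\<Sum>k. ennreal (norm (a (Suc k) \<omega> - a k \<omega>))) \<partial>M) \<noteq> \<infinity>"
    by (metis infinity_ennreal_def top.extremum_uniqueI)
  then have "AE \<omega> in M. (\<Sum>k. ennreal (norm (a (Suc k) \<omega> - a k \<omega>))) \<noteq> \<infinity>"
    by (intro nn_integral_PInf_AE) measurable
  then have conv: "AE \<omega> in M. (\<lambda>k. a k \<omega>) \<longlonglongrightarrow> lim (\<lambda>k. a k \<omega>)"
  proof eventually_elim
    case (elim \<omega>)
    then have "summable (\<lambda>k. norm (a (Suc k) \<omega> - a k \<omega>))"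
      by (intro summable_suminf_not_top) auto
    then have "summable (\<lambda>k. a (Suc k) \<omega> - a k \<omega>)" by (rule summable_norm_cancel)
    then have "convergent (\<lambda>n. \<Sum>k<n. a (Suc k) \<omega> - a k \<omega>)" by (simp add: summable_iff_convergent)
    then have "convergent (\<lambda>n. a n \<omega> - a 0 \<omega>)" by (simp add: sum_lessThan_telescope[of "\<lambda>k. a k \<omega>"])
    from convergent_add[OF this convergent_const[of "a 0 \<omega>"]] have "convergent (\<lambda>n. a n \<omega>)" by simp
    then show ?case by (simp add: convergent_LIMSEQ_iff)
  qed
  define g where "g = (\<lambda>\<omega>. if norm (lim (\<lambda>k. a k \<omega>)) \<le> C then lim (\<lambda>k. a k \<omega>) else 0)"
  have [measurable]: "g \<in> borel_measurable M" unfolding g_def by measurable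
  have g: "g \<in> bounded_by C"
    using bounded_by_nonneg[OF a] by (auto simp: bounded_by_def g_def)
  have "AE \<omega> in M. (\<lambda>k. (norm (a k \<omega> - g \<omega>))\<^sup>2) \<longlonglongrightarrow> 0"
    using conv AE_space
  proof eventually_elim
    case (elim \<omega>)
    have "norm (lim (\<lambda>k. a k \<omega>)) \<le> C"
      using LIMSEQ_le_const2[OF tendsto_norm[OF elim(1)]] bounded_byD[OF a elim(2)] by blast
    then have "(\<lambda>k. a k \<omega> - g \<omega>) \<longlonglongrightarrow> 0" using elim(1) by (simp add: g_def LIM_zero)
    then show ?case using tendsto_power[OF tendsto_norm, of _ 0 sequentially 2] by fastforce
  qed
  then have "(\<lambda>k. \<integral>\<omega>. (norm (a k \<omega> - g \<omega>))\<^sup>2 \<partial>M) \<longlonglongrightarrow> (\<integral>\<omega>. 0 \<partial>M)"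
  proof (intro integral_dominated_convergence[where w = "\<lambda>_. (C + C)\<^sup>2"])
    show "AE \<omega> in M. norm ((norm (a k \<omega> - g \<omega>))\<^sup>2) \<le> (C + C)\<^sup>2" for k
    proof (rule AE_I2)
      fix \<omega> assume "\<omega> \<in> space M"
      then have "norm (a k \<omega> - g \<omega>) \<le> C + C"
        using bounded_byD[OF bounded_by_diff[OF a g]] by simp
      then have "(norm (a k \<omega> - g \<omega>))\<^sup>2 \<le> (C + C)\<^sup>2" by (rule power_mono) simp
      then show "norm ((norm (a k \<omega> - g \<omega>))\<^sup>2) \<le> (C + C)\<^sup>2"
        by (simp only: real_norm_def abs_power2)
    qed
  qed auto
  then have "(\<lambda>k. sqrt (\<integral>\<omega>. (norm (a k \<omega> - g \<omega>))\<^sup>2 \<partial>M)) \<longlonglongrightarrow> sqrt 0"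
    by (intro tendsto_real_sqrt) simp
  then show ?thesis using g by (intro bexI[of _ g]) (simp_all add: l2norm_def)
qed

lemma bounded_Cauchy_limit:
  assumes a: "\<And>N. a N \<in> bounded_by C"
    and Cauchy: "\<And>\<epsilon>. 0 < \<epsilon> \<Longrightarrow> \<exists>t. \<forall>N\<ge>t. \<forall>N'\<ge>t. l2norm (a N - a N') \<le> \<epsilon>"
  shows "\<exists>g\<in>bounded_by C. (\<lambda>N. l2norm (a N - g)) \<longlonglongrightarrow> 0"
proof -
  have "\<exists>t. \<forall>N\<ge>t. \<forall>N'\<ge>t. l2norm (a N - a N') \<le> (1 / 2) ^ k" for k :: nat by (rule Cauchy) simp
  then obtain t where t: "\<And>k N N'. t k \<le> N \<Longrightarrow> t k \<le> N' \<Longrightarrow> l2norm (a N - a N') \<le> (1 / 2) ^ k" by metis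
  define s where "s = (\<lambda>k. \<Sum>j\<le>k. t j)"
  have s: "t k \<le> s k" "s k \<le> s (Suc k)" for k
    using member_le_sum[of k "{..k}" t] by (auto simp: s_def)
  have "l2norm (a (s (Suc k)) - a (s k)) \<le> (1 / 2) ^ k" for k
    using s[of k] by (intro t) auto
  then obtain g where g: "g \<in> bounded_by C" "(\<lambda>k. l2norm (a (s k) - g)) \<longlonglongrightarrow> 0"
    using fast_Cauchy_limit[of "\<lambda>k. a (s k)", OF a] by blast
  have "(\<lambda>N. l2norm (a N - g)) \<longlonglongrightarrow> 0"
  proof (rule LIMSEQ_I)
    fix \<epsilon> :: real assume \<epsilon>: "0 < \<epsilon>"
    have "(\<lambda>k. (1 / 2) ^ k + l2norm (a (s k) - g)) \<longlonglongrightarrow> 0 + 0"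
      by (intro tendsto_add g(2) LIMSEQ_power_zero) simp
    then have "eventually (\<lambda>k. (1 / 2) ^ k + l2norm (a (s k) - g) < \<epsilon>) sequentially"
      using order_tendstoD(2) \<epsilon> by fastforce
    then obtain k where k: "(1 / 2) ^ k + l2norm (a (s k) - g) < \<epsilon>"
      unfolding eventually_sequentially by blast
    have "norm (l2norm (a N - g) - 0) < \<epsilon>" if N: "t k \<le> N" for N
    proof -
      have "l2norm (a N - g) \<le> l2norm (a N - a (s k)) + l2norm (a (s k) - g)"
        by (rule l2norm_dist_triangle[OF a a g(1)])
      moreover have "l2norm (a N - a (s k)) \<le> (1 / 2) ^ k" using N s(1) by (rule t)
      ultimately have "l2norm (a N - g) < \<epsilon>" using k by linarith
      then show ?thesis using l2norm_nonneg[of "a N - g"] by simp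
    qed
    then show "\<exists>no. \<forall>N\<ge>no. norm (l2norm (a N - g) - 0) < \<epsilon>" by blast
  qed
  then show ?thesis using g(1) by blast
qed

end

section \<open>Rationally almost periodic weights\<close>

context int_action
begin

lemma weighted_product_in_products:
  fixes l :: nat and r :: "nat \<Rightarrow> nat \<Rightarrow> int"
  assumes "\<And>n. \<xi> (n + q) = \<xi> n" "\<And>n. norm (\<xi> n) \<le> 1" "\<And>i. i \<in> {1..l} \<Longrightarrow> f i \<in> bounded_by 1"
  shows "(\<lambda>n \<omega>. \<xi> n * (\<Prod>i=1..l. f i (S (r i n) \<omega>))) \<in> products q (r ` {1..l})"
  using assms(3)
proof (induction l)
  case 0
  then show ?case using products.periodic[of \<xi> q] assms(1,2) by simp
next
  case (Suc l)
  have "(\<lambda>n \<omega>. \<xi> n * (\<Prod>i=1..l. f i (S (r i n) \<omega>))) \<in> products q (r ` {1..Suc l})"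
    by (rule products_mono[OF Suc.IH]) (use Suc.prems in auto)
  from products.factor[OF this, of "r (Suc l)" "f (Suc l)" 0] show ?case
    using Suc.prems by (simp add: mult.assoc)
qed

lemma averages_Cauchy:
  assumes "1 \<le> q" "\<phi> \<in> products q Q" "finite Q" "\<And>r. r \<in> Q \<Longrightarrow> degree_le D r" "0 < \<epsilon>"
  shows "\<exists>t. \<forall>N\<ge>t. \<forall>N'\<ge>t. l2norm (avg N \<phi> - avg N' \<phi>) \<le> \<epsilon>"
proof -
  obtain d where "complexity_le d Q" using complexity_bounded[of "card Q" D] assms(3,4) by blast
  then have "(\<lambda>N. avg N \<phi>) \<in> averages q d" using assms(2) unfolding averages_def by blast
  from metastable_Cauchy[OF metastable_averages[OF assms(1)] this assms(5)] show ?thesis .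
qed

lemma prod_bounded:
  fixes l :: nat and r :: "nat \<Rightarrow> nat \<Rightarrow> int"
  assumes f: "\<And>i. i \<in> {1..l} \<Longrightarrow> f i \<in> bounded_by 1"
  shows "(\<lambda>\<omega>. \<Prod>i=1..l. f i (S (r i n) \<omega>)) \<in> bounded_by 1"
  using products_bounded[OF weighted_product_in_products[of "\<lambda>_. 1" 0 l f r], of n] f by simp

lemma avg_zero_one_bounded:
  fixes y :: "nat \<Rightarrow> nat"
  assumes y: "y \<in> {1..} \<rightarrow> {0, 1}" and P: "\<And>n. P n \<in> bounded_by 1"
  shows "avg N (\<lambda>n \<omega>. of_nat (y n) * P n \<omega>) \<in> bounded_by 1"
proof -
  define y' where "y' = (\<lambda>n. if n = 0 then 0 else y n)"
  have "norm (of_nat (y' n) :: complex) \<le> 1" for n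
  proof (cases "n = 0")
    case False
    then have "y n \<in> {0, 1}" using y by auto
    then show ?thesis by (auto simp: y'_def)
  qed (simp add: y'_def)
  from bounded_by_mult[OF bounded_by_const[OF this] P]
  have "avg N (\<lambda>n \<omega>. of_nat (y' n) * P n \<omega>) \<in> bounded_by 1" by (intro avg_bounded) simp
  moreover have "avg N (\<lambda>n \<omega>. of_nat (y' n) * P n \<omega>) = avg N (\<lambda>n \<omega>. of_nat (y n) * P n \<omega>)"
    by (simp add: avg_def fun_eq_iff y'_def)
  ultimately show ?thesis by simp
qed

lemma avg_weight_diff_le:
  fixes x y :: "nat \<Rightarrow> nat"
  assumes x: "x \<in> {1..} \<rightarrow> {0, 1}" and y: "y \<in> {1..} \<rightarrow> {0, 1}" and P: "\<And>n. P n \<in> bounded_by 1"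
  shows "l2norm (avg N (\<lambda>n \<omega>. of_nat (x n) * P n \<omega>) - avg N (\<lambda>n \<omega>. of_nat (y n) * P n \<omega>))
    \<le> real (card {n \<in> {1..N}. x n \<noteq> y n}) / real N"
proof (rule l2norm_le)
  let ?f = "avg N (\<lambda>n \<omega>. of_nat (x n) * P n \<omega>) - avg N (\<lambda>n \<omega>. of_nat (y n) * P n \<omega>)"
  have eq: "?f \<omega> = (\<Sum>n=1..N. (of_nat (x n) - of_nat (y n)) * P n \<omega>) / of_nat N" for \<omega>
    by (simp add: avg_def left_diff_distrib sum_subtractf diff_divide_distrib)
  have [measurable]: "P n \<in> borel_measurable M" for n by (rule bounded_by_measurable[OF P])
  have "?f \<in> borel_measurable M" unfolding eq[abs_def] by measurable
  moreover have "norm (?f \<omega>) \<le> real (card {n \<in> {1..N}. x n \<noteq> y n}) / real N" if \<omega>: "\<omega> \<in> space M" for \<omega>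
  proof -
    have "norm ((of_nat (x n) - of_nat (y n)) * P n \<omega>) \<le> (if x n \<noteq> y n then 1 else 0)" if "n \<in> {1..N}" for n
    proof -
      have "x n \<in> {0, 1}" "y n \<in> {0, 1}" using x y that by auto
      then have "norm (of_nat (x n) - of_nat (y n) :: complex) = (if x n \<noteq> y n then 1 else 0)" by auto
      then show ?thesis using bounded_byD[OF P \<omega>, of n] by (simp add: norm_mult)
    qed
    then have "norm (\<Sum>n=1..N. (of_nat (x n) - of_nat (y n)) * P n \<omega>) \<le> (\<Sum>n=1..N. if x n \<noteq> y n then 1 else 0)"
      by (rule sum_norm_le)
    also have "\<dots> = real (card {n \<in> {1..N}. x n \<noteq> y n})"
      by (simp add: sum.If_cases Int_def)
    finally show ?thesis unfolding eq by (simp add: norm_divide divide_right_mono)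
  qed
  ultimately show "?f \<in> bounded_by (real (card {n \<in> {1..N}. x n \<noteq> y n}) / real N)"
    unfolding bounded_by_def by blast
qed

text \<open>
  An \<open>\<epsilon>/3\<close> argument: for a periodic \<open>y\<close> with distance less than \<open>\<epsilon>/3\<close> from \<open>x\<close>, the averages weighted
  by \<open>y\<close> are Cauchy, and eventually those weighted by \<open>x\<close> stay within \<open>\<epsilon>/3\<close> of them.
\<close>
lemma rationally_almost_periodic_limit:
  fixes x :: "nat \<Rightarrow> nat" and l :: nat and r :: "nat \<Rightarrow> nat \<Rightarrow> int"
  assumes x: "x \<in> {1..} \<rightarrow> {0, 1}" "rationally_almost_periodic x"
    and f: "\<And>i. i \<in> {1..l} \<Longrightarrow> f i \<in> bounded_by 1"
    and r: "\<And>i. i \<in> {1..l} \<Longrightarrow> degree_le D (r i)"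
  shows "\<exists>g\<in>bounded_by 1. (\<lambda>N. l2norm (avg N (\<lambda>n \<omega>. of_nat (x n) * (\<Prod>i=1..l. f i (S (r i n) \<omega>))) - g)) \<longlonglongrightarrow> 0"
proof (rule bounded_Cauchy_limit)
  define P where "P = (\<lambda>n \<omega>. \<Prod>i=1..l. f i (S (r i n) \<omega>))"
  have P: "P n \<in> bounded_by 1" for n
    unfolding P_def using f by (rule prod_bounded)
  show "avg N (\<lambda>n \<omega>. of_nat (x n) * (\<Prod>i=1..l. f i (S (r i n) \<omega>))) \<in> bounded_by 1" for N
    using avg_zero_one_bounded[OF x(1) P] unfolding P_def .
  fix \<epsilon> :: real assume "0 < \<epsilon>"
  then have \<epsilon>: "0 < \<epsilon> / 3" by simp
  obtain y where y: "y \<in> {1..} \<rightarrow> {0, 1}" "periodic_seq y" "besicovitch_dist x y < ereal (\<epsilon> / 3)"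
    using x(2) \<epsilon> unfolding rationally_almost_periodic_def by blast
  obtain q where q: "1 \<le> q" "\<And>n. 1 \<le> n \<Longrightarrow> y (n + q) = y n" using y(2) by (auto simp: periodic_seq_def)
  \<comment> \<open>The value \<open>y 0\<close> is arbitrary; the shift by \<open>q\<close> makes the weight periodic from \<open>0\<close> on without changing it at \<open>n \<ge> 1\<close>.\<close>
  define \<xi> where "\<xi> = (\<lambda>n. of_nat (y (n + q)) :: complex)"
  have "\<xi> (n + q) = \<xi> n" for n using q(2)[of "n + q"] q(1) by (simp add: \<xi>_def)
  moreover have "norm (\<xi> n) \<le> 1" for n
  proof -
    have "y (n + q) \<in> {0, 1}" using y(1) q(1) by auto
    then show ?thesis by (auto simp: \<xi>_def)
  qed
  ultimately have "(\<lambda>n \<omega>. \<xi> n * P n \<omega>) \<in> products q (r ` {1..l})"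
    unfolding P_def using f by (rule weighted_product_in_products)
  then have "\<exists>t. \<forall>N\<ge>t. \<forall>N'\<ge>t. l2norm (avg N (\<lambda>n \<omega>. \<xi> n * P n \<omega>) - avg N' (\<lambda>n \<omega>. \<xi> n * P n \<omega>)) \<le> \<epsilon> / 3"
    by (rule averages_Cauchy[OF q(1) _ _ _ \<epsilon>, of _ _ D]) (use r in auto)
  then obtain t where
    t: "\<forall>N\<ge>t. \<forall>N'\<ge>t. l2norm (avg N (\<lambda>n \<omega>. \<xi> n * P n \<omega>) - avg N' (\<lambda>n \<omega>. \<xi> n * P n \<omega>)) \<le> \<epsilon> / 3" ..
  have \<xi>: "avg N (\<lambda>n \<omega>. \<xi> n * P n \<omega>) = avg N (\<lambda>n \<omega>. of_nat (y n) * P n \<omega>)" for N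
    using q(2) by (simp add: avg_def fun_eq_iff \<xi>_def)
  have "eventually (\<lambda>N. ereal (real (card {n \<in> {1..N}. x n \<noteq> y n}) / real N) < ereal (\<epsilon> / 3)) sequentially"
    using y(3) unfolding besicovitch_dist_def by (rule Limsup_lessD)
  then obtain t' where t': "\<And>N. t' \<le> N \<Longrightarrow> real (card {n \<in> {1..N}. x n \<noteq> y n}) / real N < \<epsilon> / 3"
    by (auto simp: eventually_sequentially)
  define X where "X = (\<lambda>N. avg N (\<lambda>n \<omega>. of_nat (x n) * P n \<omega>))"
  define Y where "Y = (\<lambda>N. avg N (\<lambda>n \<omega>. of_nat (y n) * P n \<omega>))"
  have XY: "X N \<in> bounded_by 1" "Y N \<in> bounded_by 1" for N
    unfolding X_def Y_def by (intro avg_zero_one_bounded P x(1) y(1))+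
  have near: "l2norm (X N - Y N) \<le> \<epsilon> / 3" if "t' \<le> N" for N
    using avg_weight_diff_le[where P = P and N = N, OF x(1) y(1) P] t'[OF that] unfolding X_def Y_def by linarith
  have "l2norm (X N - X N') \<le> \<epsilon>" if N: "max t t' \<le> N" "max t t' \<le> N'" for N N'
  proof -
    have "l2norm (X N - X N') \<le> l2norm (X N - Y N) + l2norm (Y N - X N')"
      by (rule l2norm_dist_triangle[OF XY(1) XY(2) XY(1)])
    moreover have "l2norm (Y N - X N') \<le> l2norm (Y N - Y N') + l2norm (Y N' - X N')"
      by (rule l2norm_dist_triangle[OF XY(2) XY(2) XY(1)])
    moreover have "l2norm (Y N' - X N') = l2norm (X N' - Y N')" by (rule l2norm_diff_commute)
    moreover have "l2norm (Y N - Y N') \<le> \<epsilon> / 3" using t N unfolding \<xi> Y_def by simp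
    ultimately show ?thesis using near[of N] near[of N'] N by simp
  qed
  then show "\<exists>t. \<forall>N\<ge>t. \<forall>N'\<ge>t. l2norm (avg N (\<lambda>n \<omega>. of_nat (x n) * (\<Prod>i=1..l. f i (S (r i n) \<omega>)))
      - avg N' (\<lambda>n \<omega>. of_nat (x n) * (\<Prod>i=1..l. f i (S (r i n) \<omega>)))) \<le> \<epsilon>"
    unfolding X_def P_def by blast
qed

end

section \<open>Invertible systems\<close>

lemma distr_funpow:
  assumes "T \<in> measurable M M" "distr M M T = M"
  shows "T ^^ n \<in> measurable M M \<and> distr M M (T ^^ n) = M"
proof (induction n)
  case 0
  then show ?case by (simp add: id_def)
next
  case (Suc n)
  have "T \<circ> T ^^ n \<in> measurable M M" by (rule measurable_comp[OF conjunct1[OF Suc] assms(1)])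
  moreover have "distr M M (T \<circ> T ^^ n) = distr (distr M M (T ^^ n)) M T"
    using Suc assms(1) by (intro distr_distr[symmetric]) auto
  ultimately show ?case using Suc assms(2) by (simp only: funpow.simps)
qed

lemma int_action_of_invertible_mps:
  assumes "invertible_mps M T"
  shows "int_action M (int_iterate M T)"
proof -
  define T' where "T' = the_inv_into (space M) T"
  have prob: "prob_space M" and bij: "bij_betw T (space M) (space M)"
    and meas: "T \<in> measurable M M" "T' \<in> measurable M M"
    and pres: "\<And>A. A \<in> sets M \<Longrightarrow> emeasure M (T -` A \<inter> space M) = emeasure M A"
    using assms by (auto simp: invertible_mps_def T'_def)
  have inv: "T' (T \<omega>) = \<omega>" "T (T' \<omega>) = \<omega>" if "\<omega> \<in> space M" for \<omega>
    using bij that unfolding T'_def bij_betw_def by (auto simp: the_inv_into_f_f f_the_inv_into_f)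
  have distr_T: "distr M M T = M"
    using pres meas(1) by (intro measure_eqI) (auto simp: emeasure_distr)
  have "distr M M T' = distr (distr M M T) M T'" by (simp only: distr_T)
  also have "\<dots> = distr M M (T' \<circ> T)" using meas by (intro distr_distr) auto
  also have "\<dots> = distr M M (\<lambda>\<omega>. \<omega>)" using inv(1) by (intro distr_cong) auto
  finally have distr_T': "distr M M T' = M" by simp
  have S: "int_iterate M T m \<in> measurable M M \<and> distr M M (int_iterate M T m) = M" for m
    using distr_funpow[OF meas(1) distr_T] distr_funpow[OF meas(2) distr_T']
    by (simp add: int_iterate_def T'_def)
  have space: "int_iterate M T m \<omega> \<in> space M" if "\<omega> \<in> space M" for m \<omega>
    using S[of m] that by (auto dest: measurable_space)
  have step: "int_iterate M T (m + 1) \<omega> = T (int_iterate M T m \<omega>)" if \<omega>: "\<omega> \<in> space M" for m \<omega>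
  proof (cases "0 \<le> m")
    case True
    then have "nat (m + 1) = Suc (nat m)" by simp
    then show ?thesis using True by (simp add: int_iterate_def)
  next
    case False
    then have "nat (- m) = Suc (nat (- (m + 1)))" by simp
    then have "int_iterate M T m \<omega> = T' ((T' ^^ nat (- (m + 1))) \<omega>)"
      using False by (simp add: int_iterate_def T'_def)
    moreover have "(T' ^^ nat (- (m + 1))) \<omega> = int_iterate M T (m + 1) \<omega>"
      using False by (cases "m = -1") (auto simp: int_iterate_def T'_def)
    ultimately show ?thesis using inv(2) space[OF \<omega>, of "m + 1"] by simp
  qed
  have step': "int_iterate M T (m - 1) \<omega> = T' (int_iterate M T m \<omega>)" if "\<omega> \<in> space M" for m \<omega>
    using step[OF that, of "m - 1"] inv(1) space[OF that] by simp
  have add: "int_iterate M T (j + k) \<omega> = int_iterate M T j (int_iterate M T k \<omega>)" if \<omega>: "\<omega> \<in> space M" for j k \<omega>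
  proof (induction j rule: int_induct[where k = 0])
    case base
    then show ?case by (simp add: int_iterate_def)
  next
    case (step1 i)
    have "int_iterate M T (i + 1 + k) \<omega> = T (int_iterate M T (i + k) \<omega>)"
      using step[OF \<omega>, of "i + k"] by (simp add: algebra_simps)
    then show ?case using step1 step[OF space[OF \<omega>], of i k] by simp
  next
    case (step2 i)
    have "int_iterate M T (i - 1 + k) \<omega> = T' (int_iterate M T (i + k) \<omega>)"
      using step'[OF \<omega>, of "i + k"] by (simp add: algebra_simps)
    then show ?case using step2 step'[OF space[OF \<omega>], of i k] by simp
  qed
  interpret prob_space M by (rule prob)
  show ?thesis
    by unfold_locales (use S add in \<open>auto simp: int_iterate_def\<close>)
qed

lemma Linf_common_bound:
  assumes "finite I" "\<And>i. i \<in> I \<Longrightarrow> f i \<in> Linf M"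
  shows "\<exists>C\<ge>1. \<forall>i\<in>I. AE \<omega> in M. norm (f i \<omega>) \<le> C"
proof -
  have "\<exists>C. \<forall>i\<in>I. AE \<omega> in M. norm (f i \<omega>) \<le> C i" using assms(2) by (simp add: Linf_def) metis
  then obtain C where C: "\<And>i. i \<in> I \<Longrightarrow> AE \<omega> in M. norm (f i \<omega>) \<le> C i" by blast
  define D where "D = Max (insert 1 (C ` I))"
  have "1 \<le> D" "\<And>i. i \<in> I \<Longrightarrow> C i \<le> D" using assms(1) by (auto simp: D_def)
  moreover have "AE \<omega> in M. norm (f i \<omega>) \<le> D" if "i \<in> I" for i
    using C[OF that] by eventually_elim (use \<open>\<And>i. i \<in> I \<Longrightarrow> C i \<le> D\<close>[OF that] in simp)
  ultimately show ?thesis by blast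
qed

theorem proposition2p3:
  fixes x :: "nat \<Rightarrow> nat" and M :: "'a measure" and T :: "'a \<Rightarrow> 'a" and l :: nat
    and f :: "nat \<Rightarrow> 'a \<Rightarrow> complex" and p :: "nat \<Rightarrow> rat poly"
  assumes "x \<in> {1..} \<rightarrow> {0, 1}"
    and "rationally_almost_periodic x"
    and "invertible_mps M T"
    and "l \<ge> 1"
    and "\<And>i. i \<in> {1..l} \<Longrightarrow> f i \<in> Linf M"
    and "\<And>i. i \<in> {1..l} \<Longrightarrow> integer_valued (p i)"
  shows "\<exists>g. has_L2_limit M (weighted_poly_average x M T l p f) g"
proof -
  define S where "S = int_iterate M T"
  interpret int_action M S unfolding S_def by (rule int_action_of_invertible_mps[OF assms(3)])
  obtain C where C: "1 \<le> C" "\<And>i. i \<in> {1..l} \<Longrightarrow> AE \<omega> in M. norm (f i \<omega>) \<le> C"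
    using Linf_common_bound[of "{1..l}" f M] assms(5) by blast
  have [measurable]: "f i \<in> borel_measurable M" if "i \<in> {1..l}" for i using assms(5)[OF that] by (simp add: Linf_def)
  define f' where "f' = (\<lambda>i \<omega>. if norm (f i \<omega>) \<le> C then f i \<omega> / of_real C else 0)"
  have f': "f' i \<in> bounded_by 1" if i: "i \<in> {1..l}" for i
  proof -
    have "f' i \<in> borel_measurable M" unfolding f'_def using i by measurable
    then show ?thesis using C(1) by (auto simp: bounded_by_def f'_def norm_divide)
  qed
  define r where "r = (\<lambda>i (n::nat). \<lfloor>poly (p i) (of_nat n)\<rfloor>)"
  define D where "D = Max (insert 0 ((\<lambda>i. degree (p i)) ` {1..l}))"
  have r: "degree_le D (r i)" if i: "i \<in> {1..l}" for i
  proof (rule degree_le_poly)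
    show "degree (p i) \<le> D" using i by (simp add: D_def)
    show "of_int (r i n) = poly (p i) (of_nat n)" for n
      using assms(6)[OF i] unfolding integer_valued_def r_def
      by (metis Ints_cases floor_of_int of_int_of_nat_eq)
  qed
  define A where "A = (\<lambda>N. avg N (\<lambda>n \<omega>. of_nat (x n) * (\<Prod>i=1..l. f' i (S (r i n) \<omega>))))"
  obtain g where g: "g \<in> bounded_by 1" "(\<lambda>N. l2norm (A N - g)) \<longlonglongrightarrow> 0"
    using rationally_almost_periodic_limit[where f = f' and r = r and l = l and D = D, OF assms(1,2) f' r] unfolding A_def by blast
  have "AE \<omega> in M. \<forall>i\<in>{1..l}. \<forall>m. norm (f i (S m \<omega>)) \<le> C"
  proof (rule AE_finite_allI)
    fix i assume i: "i \<in> {1..l}"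
    have "AE \<omega> in M. norm (f i (S m \<omega>)) \<le> C" for m
      by (rule AE_distrD[OF S_measurable]) (unfold S_preserving, rule C(2)[OF i])
    then show "AE \<omega> in M. \<forall>m. norm (f i (S m \<omega>)) \<le> C" by (simp add: AE_all_countable)
  qed simp
  then have eq: "AE \<omega> in M. \<forall>N. weighted_poly_average x M T l p f N \<omega> = of_real C ^ l * A N \<omega>"
  proof eventually_elim
    case (elim \<omega>)
    have "koopman M T (r i n) (f i) \<omega> = of_real C * f' i (S (r i n) \<omega>)" if "i \<in> {1..l}" for i n
      using elim that C(1) by (auto simp: koopman_def f'_def S_def)
    then have prod: "(\<Prod>i=1..l. koopman M T (r i n) (f i) \<omega>) = of_real C ^ l * (\<Prod>i=1..l. f' i (S (r i n) \<omega>))" for n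
      by (simp add: prod.distrib)
    have "weighted_poly_average x M T l p f N \<omega>
        = 1 / of_nat N * (\<Sum>n=1..N. of_nat (x n) * (\<Prod>i=1..l. koopman M T (r i n) (f i) \<omega>))" for N
      by (simp only: weighted_poly_average_def r_def)
    then show ?case
      unfolding prod A_def avg_def by (simp add: sum_distrib_left sum_divide_distrib mult_ac)
  qed
  define h where "h = (\<lambda>\<omega>. of_real C ^ l * g \<omega>)"
  have h: "h \<in> bounded_by (C ^ l * 1)"
    unfolding h_def using C(1) by (intro bounded_by_mult bounded_by_const g(1)) (simp add: norm_power)
  have A: "A N \<in> bounded_by 1" for N
    unfolding A_def by (intro avg_zero_one_bounded assms(1) prod_bounded f')
  have "(\<integral>\<^sup>+ \<omega>. ennreal ((norm (weighted_poly_average x M T l p f N \<omega> - h \<omega>))\<^sup>2) \<partial>M)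
      = ennreal ((C ^ l * l2norm (A N - g))\<^sup>2)" for N
  proof -
    have "(\<integral>\<^sup>+ \<omega>. ennreal ((norm (weighted_poly_average x M T l p f N \<omega> - h \<omega>))\<^sup>2) \<partial>M)
        = (\<integral>\<^sup>+ \<omega>. ennreal ((norm (of_real C ^ l * (A N - g) \<omega>))\<^sup>2) \<partial>M)"
    proof (rule nn_integral_cong_AE)
      show "AE \<omega> in M. ennreal ((norm (weighted_poly_average x M T l p f N \<omega> - h \<omega>))\<^sup>2)
          = ennreal ((norm (of_real C ^ l * (A N - g) \<omega>))\<^sup>2)"
        using eq by eventually_elim (simp add: h_def right_diff_distrib)
    qed
    also have "\<dots> = ennreal ((l2norm (\<lambda>\<omega>. of_real C ^ l * (A N - g) \<omega>))\<^sup>2)"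
      unfolding l2norm_sq
      by (intro nn_integral_eq_integral integrable_norm_sq[OF bounded_by_mult[OF bounded_by_const[OF order_refl]
          bounded_by_diff[OF A g(1)]]]) auto
    also have "l2norm (\<lambda>\<omega>. of_real C ^ l * (A N - g) \<omega>) = C ^ l * l2norm (A N - g)"
      unfolding l2norm_scale using C(1) by (simp add: norm_power del: minus_apply)
    finally show ?thesis .
  qed
  moreover have "(\<lambda>N. ennreal ((C ^ l * l2norm (A N - g))\<^sup>2)) \<longlonglongrightarrow> ennreal ((C ^ l * 0)\<^sup>2)"
    by (intro tendsto_ennrealI tendsto_power tendsto_mult_left g(2))
  ultimately have "has_L2_limit M (weighted_poly_average x M T l p f) h"
    unfolding has_L2_limit_def L2_def using integrable_norm_sq[OF h] bounded_by_measurable[OF h] by simp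
  then show ?thesis by blast
qed

end
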